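(* Let $W:\mathbb{R}^d\to\mathbb{R}\cup\{\infty\}$ be locally integrable, bounded from below and lower-semicontinuous, with $W(\mathbf{x})=W(-\mathbf{x})$, and assume $$\lim_{|\mathbf{x}|\to\infty}W(\mathbf{x})=:W_\infty\in\mathbb{R}\cup\{\infty\}.$$ Then there exists a minimizer of $E_W$ in $\mathcal{M}(\mathbb{R}^d)$ if and only if there exists $\rho\in\mathcal{M}(\mathbb{R}^d)$ such that $E_W[\rho]\le\frac12W_\infty$. Furthermore, if there exists $\rho\in\mathcal{M}(\mathbb{R}^d)$ such that $E_W[\rho]<\frac12W_\infty$, i.e. $\inf_{\rho\in\mathcal{M}(\mathbb{R}^d)}E_W[\rho]<\frac12W_\infty$, then any minimizer of $E_W$ in $\mathcal{M}(\mathbb{R}^d)$ is compactly supported, and there exists $R>0$ depending on $W$ such that any minimizer $\rho$ satisfies $\mathrm{diam}(\mathrm{supp}\,\rho)\le R$.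
   Context: $\mathcal{M}(\mathbb{R}^d)$ is the set of Borel probability measures on $\mathbb{R}^d$. $E_W[\rho]=\frac12\int\int W(\mathbf{x}-\mathbf{y})\,d\rho(\mathbf{y})\,d\rho(\mathbf{x})$, with values in $\mathbb{R}\cup\{\infty\}$. *)

theory Defs
  imports "HOL-Probability.Probability"
begin

definition borel_prob :: "(real ^ 'd) measure set" where
  "borel_prob = {\<rho>. prob_space \<rho> \<and> sets \<rho> = sets borel}"

(* Integral of an extended-real-valued function, as the difference of the integrals of its
   positive and negative parts; e2ennreal sends negative arguments to 0. It is meaningful when
   one of the two parts has finite integral, which holds for probability measures and
   integrands bounded from below. *)
definition ereal_lint :: "'a measure \<Rightarrow> ('a \<Rightarrow> ereal) \<Rightarrow> ereal" where
  "ereal_lint M f =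
     enn2ereal (\<integral>\<^sup>+ x. e2ennreal (f x) \<partial>M) - enn2ereal (\<integral>\<^sup>+ x. e2ennreal (- f x) \<partial>M)"

definition energy :: "(real ^ 'd \<Rightarrow> ereal) \<Rightarrow> (real ^ 'd) measure \<Rightarrow> ereal" where
  "energy W \<rho> = ereal (1/2) * ereal_lint \<rho> (\<lambda>x. ereal_lint \<rho> (\<lambda>y. W (x - y)))"

definition energy_minimizer :: "(real ^ 'd \<Rightarrow> ereal) \<Rightarrow> (real ^ 'd) measure \<Rightarrow> bool" where
  "energy_minimizer W \<rho> \<longleftrightarrow> \<rho> \<in> borel_prob \<and> (\<forall>\<sigma>\<in>borel_prob. energy W \<rho> \<le> energy W \<sigma>)"

definition measure_supp :: "(real ^ 'd) measure \<Rightarrow> (real ^ 'd) set" where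
  "measure_supp \<rho> = {x. \<forall>U. open U \<and> x \<in> U \<longrightarrow> emeasure \<rho> U > 0}"

definition locally_integrable :: "(real ^ 'd \<Rightarrow> ereal) \<Rightarrow> bool" where
  "locally_integrable f \<longleftrightarrow> f \<in> borel_measurable lebesgue \<and>
     (\<forall>K. compact K \<longrightarrow> (\<integral>\<^sup>+ x \<in> K. e2ennreal \<bar>f x\<bar> \<partial>lebesgue) < \<infinity>)"

(* "at x" excludes x itself, which makes no difference to this condition. *)
definition lower_semicontinuous :: "(real ^ 'd \<Rightarrow> ereal) \<Rightarrow> bool" where
  "lower_semicontinuous f \<longleftrightarrow> (\<forall>x. f x \<le> Liminf (at x) f)"

end

theory Submission
  imports Defs
begin

text \<open>
  Choose a real \<open>m \<le> 0\<close> below \<open>W\<close> and put \<open>w = W - m\<close>. The energy is then an increasing affine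
  function of \<open>Q(\<rho>) = \<integral>\<integral> w(x - y) d\<rho> d\<rho>\<close>, so every claim becomes a claim about a nonnegative, even,
  lower semicontinuous kernel \<open>w\<close> with limit \<open>L\<close> at infinity, for which all integrals make sense in
  \<open>[0, \<infinity>]\<close>.

  \<^emph>\<open>The infimum is at most \<open>L\<close>.\<close> The uniform distribution on a large ball has energy close to
  \<open>L\<close>: most pairs of points are far apart, and local integrability bounds the contribution
  of the close pairs by a constant over the volume (\<open>ex_self_energy_less\<close>). Hence a minimizer has
  energy at most \<open>L\<close>.

  \<^emph>\<open>Minimizers below \<open>L\<close> cannot spread.\<close> Let \<open>\<rho>\<close> minimize \<open>Q\<close> among the measures
  concentrated on some set \<open>K\<close>, with \<open>Q(\<rho>) \<le> q < c\<close>, where \<open>w \<ge> c\<close> outside a ball of radius \<open>r\<close>.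
  Restricting \<open>\<rho>\<close> to a set \<open>A\<close> or to its complement and normalizing cannot lower the energy;
  by bilinearity, the interaction of \<open>A\<close> with \<open>- A\<close> is at most \<open>\<rho>(A) \<rho>(- A) q\<close>
  (\<open>minimizer_cross_energy_le\<close>). If \<open>A\<close> and \<open>B\<close> have distance at least \<open>r\<close>, this gives
  \<open>c \<rho>(B) \<le> q \<rho>(- A)\<close> (\<open>minimizer_separated\<close>). Apply it to a ball of radius \<open>t\<close>
  and the complement of the concentric ball of radius \<open>t + r\<close>, in both roles. With \<open>\<theta> = q / c < 1\<close>
  and \<open>m(t)\<close> the mass of the ball of radius \<open>t\<close>, the result is that \<open>m(2 r) \<ge> 1 - \<theta>\<close> as soon as
  \<open>m(r) > 0\<close>, and that \<open>m(t) \<le> \<theta> m(t + r)\<close> as long as \<open>m(t + r) < 1\<close>. Geometric growth forces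
  \<open>m(D) = 1\<close> for a radius \<open>D\<close> that depends on \<open>q\<close>, \<open>c\<close> and \<open>r\<close> only, and not on \<open>K\<close>
  (\<open>minimizer_concentration_radius\<close>). For \<open>K = UNIV\<close> this is the claim on supports.

  \<^emph>\<open>Existence.\<close> On a compact set a minimizer exists by the direct method
  (\<open>ex_minimizer_on_compact\<close>). If some energy lies below \<open>L\<close>, then the minimizers on all large balls
  can be translated into one fixed ball, because \<open>D\<close> does not depend on the ball. So
  the minimizer on that fixed ball is optimal among all compactly supported measures, and
  truncation makes it optimal among all measures (\<open>ex_minimizer\<close>). If no energy is
  below that of a measure of energy at most \<open>L\<close>, this measure is itself a minimizer.

  The direct method needs sequential compactness of the probability measures on a bounded set.
  It is derived from Helly's selection theorem on the line: a continuous curve through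
  the unit cube that has a Borel section identifies measures on the cube with measures on the unit
  interval. Skorohod's theorem on the line, composed with the curve, then yields random vectors that
  converge pointwise (\<open>bounded_imp_subseq_Skorohod\<close>), and lower semicontinuity of the energy
  is Fatou's lemma.
\<close>

section \<open>A space-filling curve with a Borel section\<close>

definition binary_digit :: "real \<Rightarrow> nat \<Rightarrow> int" where
  "binary_digit x n = \<lfloor>2 ^ Suc n * x\<rfloor> mod 2"

lemma binary_digit_cases: "binary_digit x n = 0 \<or> binary_digit x n = 1"
  by (auto simp: binary_digit_def)

lemma binary_digit_eq:
  "binary_digit x n = \<lfloor>2 ^ Suc n * x\<rfloor> - 2 * \<lfloor>2 ^ n * x\<rfloor>"
proof -
  have "\<lfloor>2 ^ n * x\<rfloor> = \<lfloor>2 ^ Suc n * x\<rfloor> div 2"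
    using floor_divide_real_eq_div[of 2 "2 ^ Suc n * x"] by simp
  then show ?thesis
    unfolding binary_digit_def by (simp add: minus_mult_div_eq_mod[symmetric])
qed

lemma measurable_binary_digit [measurable]:
  "(\<lambda>x. real_of_int (binary_digit x n)) \<in> borel_measurable borel"
  unfolding binary_digit_eq by simp

lemma binary_expansion:
  assumes "0 \<le> x" "x < 1"
  shows "(\<lambda>n. real_of_int (binary_digit x n) / 2 ^ Suc n) sums x"
proof -
  have partial: "(\<Sum>k<n. real_of_int (binary_digit x k) / 2 ^ Suc k) = \<lfloor>2 ^ n * x\<rfloor> / 2 ^ n" for n
  proof (induction n)
    case 0
    then show ?case using assms by (simp add: floor_eq_iff)
  next
    case (Suc n)
    have "real_of_int (binary_digit x n)
        = real_of_int \<lfloor>2 ^ Suc n * x\<rfloor> - 2 * real_of_int \<lfloor>2 ^ n * x\<rfloor>"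
      by (simp add: binary_digit_eq)
    with Suc show ?case by (simp add: field_simps)
  qed
  have "(\<lambda>n. \<lfloor>2 ^ n * x\<rfloor> / 2 ^ n) \<longlonglongrightarrow> x"
  proof (rule tendsto_sandwich[OF _ _ _ tendsto_const])
    show "\<forall>\<^sub>F n in sequentially. x - (1/2) ^ n \<le> \<lfloor>2 ^ n * x\<rfloor> / 2 ^ n"
    proof (intro always_eventually allI)
      fix n
      have "2 ^ n * x - 1 \<le> \<lfloor>2 ^ n * x\<rfloor>" by linarith
      then have "(2 ^ n * x - 1) / 2 ^ n \<le> \<lfloor>2 ^ n * x\<rfloor> / 2 ^ n"
        by (intro divide_right_mono) auto
      then show "x - (1/2) ^ n \<le> \<lfloor>2 ^ n * x\<rfloor> / 2 ^ n"
        by (simp add: diff_divide_distrib power_divide)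
    qed
    show "\<forall>\<^sub>F n in sequentially. \<lfloor>2 ^ n * x\<rfloor> / 2 ^ n \<le> x"
      by (intro always_eventually allI) (simp add: divide_le_eq mult.commute)
    have "(\<lambda>n. x - (1/2) ^ n) \<longlonglongrightarrow> x - 0"
      by (intro tendsto_intros LIMSEQ_power_zero) auto
    then show "(\<lambda>n. x - (1/2) ^ n) \<longlonglongrightarrow> x" by simp
  qed
  then show ?thesis
    unfolding sums_def partial .
qed

text \<open>
  A continuous function of period \<open>2\<close> that is \<open>0\<close> on \<open>[0, 1/3]\<close> and \<open>1\<close> on \<open>[2/3, 1]\<close>. It plays the
  role of the piecewise linear function in Schoenberg's construction of a space-filling curve.
\<close>

definition digit_bump :: "real \<Rightarrow> real" where
  "digit_bump u = max 0 (min 1 (1/2 - cos (pi * u)))"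

lemma digit_bump_bounds: "0 \<le> digit_bump u" "digit_bump u \<le> 1"
  by (auto simp: digit_bump_def)

lemma continuous_on_digit_bump [continuous_intros]:
  fixes f :: "real \<Rightarrow> real"
  shows "continuous_on A f \<Longrightarrow> continuous_on A (\<lambda>x. digit_bump (f x))"
  unfolding digit_bump_def by (intro continuous_intros)

lemma digit_bump_shift: "digit_bump (2 * of_int n + u) = digit_bump u"
proof -
  have "cos (pi * (2 * of_int n + u)) = cos (pi * u + 2 * pi * of_int n)"
    by (simp add: algebra_simps)
  also have "\<dots> = cos (pi * u)"
    using cos_int_2pin[of n] sin_int_2pin[of n] by (simp add: cos_add mult.assoc)
  finally show ?thesis by (simp add: digit_bump_def)
qed

lemma digit_bump_eq_0:
  assumes "0 \<le> u" "u \<le> 1/3" shows "digit_bump u = 0"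
proof -
  have "cos (pi/3) \<le> cos (pi * u)"
    using assms by (intro cos_monotone_0_pi_le) (auto simp: field_simps)
  then show ?thesis by (simp add: digit_bump_def cos_60)
qed

lemma digit_bump_eq_1:
  assumes "2/3 \<le> u" "u \<le> 1" shows "digit_bump u = 1"
proof -
  have "cos (pi * u) \<le> cos (2 * pi / 3)"
    using assms by (intro cos_monotone_0_pi_le) (auto simp: field_simps)
  moreover have "cos (2 * pi / 3) = - (1/2)"
    by (simp add: cos_120)
  ultimately show ?thesis by (simp add: digit_bump_def)
qed

text \<open>
  Multiplying a Cantor point \<open>\<Sum>j. 2 a\<^sub>j / 3\<^sup>j\<^sup>+\<^sup>1\<close> by \<open>3\<^sup>k\<close> turns the digits before the \<open>k\<close>-th one into
  an even integer, a period of the bump; the remaining ones add up to a number in \<open>[0, 1/3]\<close> or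
  \<open>[2/3, 1]\<close> according to \<open>a\<^sub>k\<close>. The bump therefore reads off single digits of a Cantor point
  continuously.
\<close>

lemma digit_bump_ternary:
  fixes a :: "nat \<Rightarrow> int"
  assumes a: "\<And>k. a k = 0 \<or> a k = 1"
  shows "digit_bump (3 ^ k * (\<Sum>j. 2 * real_of_int (a j) / 3 ^ Suc j)) = a k"
proof -
  have a01: "0 \<le> a j" "a j \<le> 1" for j using a[of j] by auto
  have geo: "(\<lambda>j. 2 / 3 ^ Suc (Suc j) :: real) sums (1/3)"
    using sums_mult[OF geometric_sums[of "1/3::real"], of "2/9"] by (simp add: power_divide)
  have summ: "summable (\<lambda>j. 2 * real_of_int (b j) / 3 ^ Suc (Suc j))"
    if "\<And>j. b j = 0 \<or> b j = 1" for b :: "nat \<Rightarrow> int"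
  proof (rule summable_comparison_test'[OF sums_summable[OF geo], of 0])
    show "norm (2 * real_of_int (b j) / 3 ^ Suc (Suc j)) \<le> 2 / 3 ^ Suc (Suc j)" for j
      using that[of j] by auto
  qed
  have summ1: "summable (\<lambda>j. 2 * real_of_int (b j) / 3 ^ Suc j)"
    if "\<And>j. b j = 0 \<or> b j = 1" for b :: "nat \<Rightarrow> int"
    using summable_mult[OF summ[OF that], of 3] by simp
  define T where "T = (\<Sum>j. 2 * real_of_int (a (j + Suc k)) / 3 ^ Suc (Suc j))"
  have T0: "0 \<le> T" unfolding T_def by (intro suminf_nonneg summ a) (use a01 in auto)
  have "T \<le> (\<Sum>j. 2 / 3 ^ Suc (Suc j))" unfolding T_def
    by (intro suminf_le summ a sums_summable[OF geo]) (use a01 in \<open>auto simp: divide_right_mono\<close>)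
  then have T1: "T \<le> 1/3" using sums_unique[OF geo] by simp
  define N where "N = (\<Sum>j<k. a j * 3 ^ (k - Suc j))"
  have head: "3 ^ k * (\<Sum>j<k. 2 * real_of_int (a j) / 3 ^ Suc j) = 2 * of_int N"
  proof -
    have "3 ^ k * (2 * real_of_int (a j) / 3 ^ Suc j) = 2 * (a j * 3 ^ (k - Suc j))" if "j < k" for j
    proof -
      have "(3::real) ^ k = 3 ^ (k - Suc j) * 3 ^ Suc j"
        using that by (subst power_add[symmetric]) simp
      then show ?thesis by simp
    qed
    then show ?thesis by (simp add: N_def sum_distrib_left)
  qed
  have tail: "3 ^ k * (\<Sum>j. 2 * real_of_int (a (j + Suc k)) / 3 ^ Suc (j + Suc k)) = T"
    unfolding T_def
    by (subst suminf_mult[symmetric])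
       (use summable_ignore_initial_segment[OF summ1, of a "Suc k"] a in
          \<open>auto simp: power_add field_simps\<close>)
  have "3 ^ k * (\<Sum>j. 2 * real_of_int (a j) / 3 ^ Suc j)
      = 3 ^ k * ((\<Sum>j. 2 * real_of_int (a (j + Suc k)) / 3 ^ Suc (j + Suc k))
         + (\<Sum>j<Suc k. 2 * real_of_int (a j) / 3 ^ Suc j))"
    by (subst suminf_split_initial_segment[OF summ1, of a "Suc k"]) (use a in auto)
  also have "\<dots> = 2 * of_int N + (2 / 3 * a k + T)"
    using head tail by (simp add: algebra_simps)
  finally have eq: "3 ^ k * (\<Sum>j. 2 * real_of_int (a j) / 3 ^ Suc j)
     = 2 * of_int N + (2 / 3 * a k + T)" .
  show ?thesis
    unfolding eq digit_bump_shift
    using a[of k] T0 T1 digit_bump_eq_0[of T] digit_bump_eq_1[of "2 / 3 + T"] by auto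
qed

text \<open>
  Schoenberg's curve. The binary digits of all coordinates of a point are interleaved into the digits
  of one Cantor point (the section), and the bump recovers them (the curve). The section
  depends on the point only through its binary digits and is therefore Borel, though not
  continuous. The cube is half-open because the digit function does not represent \<open>1\<close>.
\<close>

theorem continuous_curve_with_measurable_section:
  obtains g :: "real \<Rightarrow> 'a::euclidean_space" and s :: "'a \<Rightarrow> real"
  where "continuous_on UNIV g" "s \<in> borel_measurable borel" "\<And>x. 0 \<le> s x" "\<And>x. s x \<le> 1"
    "\<And>x. (\<And>b. b \<in> Basis \<Longrightarrow> 0 \<le> x \<bullet> b \<and> x \<bullet> b < 1) \<Longrightarrow> g (s x) = x"
proof -
  define d where "d = DIM('a)"
  obtain e where e: "bij_betw e (Basis :: 'a set) {..<d}"
    using ex_bij_betw_finite_nat[of "Basis :: 'a set"] by (auto simp: d_def atLeast0LessThan)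
  define e' where "e' = inv_into Basis e"
  have e_lt: "e b < d" and e': "e' (e b) = b" if "b \<in> Basis" for b
    using e that by (auto simp: bij_betw_def e'_def)
  \<comment> \<open>The \<open>n\<close>-th binary digit of coordinate \<open>b\<close> sits at position \<open>n * d + e b\<close> of the Cantor point.\<close>
  define coord where "coord b t = (\<Sum>n. digit_bump (3 ^ (n * d + e b) * t) / 2 ^ Suc n)"
    for b and t :: real
  define g where "g t = (\<Sum>b\<in>Basis. coord b t *\<^sub>R b)" for t
  define a where "a x k = binary_digit (x \<bullet> e' (k mod d)) (k div d)" for x :: 'a and k
  define s where "s x = (\<Sum>k. 2 * real_of_int (a x k) / 3 ^ Suc k)" for x
  have a01: "a x k = 0 \<or> a x k = 1" for x k
    unfolding a_def by (rule binary_digit_cases)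
  have geo: "(\<lambda>n. 1 / 2 ^ Suc n :: real) sums 1"
    using power_half_series by (simp add: power_divide)
  have geo3: "(\<lambda>n. 2 / 3 ^ Suc n :: real) sums 1"
    using sums_mult[OF geometric_sums[of "1/3::real"], of "2/3"] by (simp add: power_divide)
  have bnd: "norm (2 * real_of_int (a x k) / 3 ^ Suc k) \<le> 2 / 3 ^ Suc k" for x k
    using a01[of x k] by auto
  have "continuous_on UNIV (coord b)" for b
  proof (rule uniform_limit_theorem)
    show "uniform_limit UNIV (\<lambda>N t. \<Sum>n<N. digit_bump (3 ^ (n * d + e b) * t) / 2 ^ Suc n)
       (coord b) sequentially"
      unfolding coord_def
      by (rule Weierstrass_m_test[OF _ sums_summable[OF geo]])
         (use digit_bump_bounds in \<open>auto simp: divide_right_mono\<close>)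
  qed (auto intro!: always_eventually continuous_intros)
  then have cont: "continuous_on UNIV g"
    unfolding g_def by (intro continuous_intros) (auto simp: continuous_on_eq_continuous_at)
  have summ: "summable (\<lambda>k. 2 * real_of_int (a x k) / 3 ^ Suc k)" for x
    by (rule summable_comparison_test'[OF sums_summable[OF geo3], of 0]) (rule bnd)
  have pos: "0 \<le> s x" for x
    unfolding s_def by (intro suminf_nonneg summ) (use a01[of x] in \<open>force simp: a_def binary_digit_def\<close>)
  have "s x \<le> (\<Sum>k. 2 / 3 ^ Suc k)" for x
    unfolding s_def using bnd[of x] by (intro suminf_le summ sums_summable[OF geo3]) (auto intro: abs_le_D1)
  then have le1: "s x \<le> 1" for x using sums_unique[OF geo3] by simp
  have meas: "s \<in> borel_measurable borel"
    unfolding s_def a_def by measurable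
  have "g (s x) = x" if x: "\<And>b. b \<in> Basis \<Longrightarrow> 0 \<le> x \<bullet> b \<and> x \<bullet> b < 1" for x
  proof -
    have "coord b (s x) = x \<bullet> b" if b: "b \<in> Basis" for b
    proof -
      have "digit_bump (3 ^ (n * d + e b) * s x) = binary_digit (x \<bullet> b) n" for n
        unfolding s_def digit_bump_ternary[OF a01] using e_lt[OF b] e'[OF b] by (simp add: a_def)
      then show ?thesis
        unfolding coord_def using binary_expansion[of "x \<bullet> b"] x[OF b] by (simp add: sums_unique[symmetric])
    qed
    then show ?thesis unfolding g_def by (simp add: euclidean_representation)
  qed
  with that cont meas pos le1 show ?thesis by blast
qed

section \<open>Compactness of probability measures on bounded sets\<close>

text \<open>
  Prokhorov's and Skorohod's theorems combined, for measures on a bounded set. The section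
  of the curve transports the measures to the unit interval, where Helly's theorem and the
  Skorohod theorem for the line apply; the curve transports the resulting random variables back,
  and its continuity preserves their pointwise convergence.
\<close>

lemma bounded_imp_subseq_Skorohod:
  fixes \<rho> :: "nat \<Rightarrow> 'a::euclidean_space measure" and K :: "'a set"
  assumes prob: "\<And>n. prob_space (\<rho> n)" and sets: "\<And>n. sets (\<rho> n) = sets borel"
    and K: "bounded K" "\<And>n. AE x in \<rho> n. x \<in> K"
  obtains r :: "nat \<Rightarrow> nat" and \<Omega> :: "real measure" and X Y
  where "strict_mono r" "prob_space \<Omega>"
    "\<And>n. X n \<in> borel_measurable \<Omega>" "Y \<in> borel_measurable \<Omega>"
    "\<And>n. distr \<Omega> borel (X n) = \<rho> (r n)"
    "\<And>\<omega>. \<omega> \<in> space \<Omega> \<Longrightarrow> (\<lambda>n. X n \<omega>) \<longlonglongrightarrow> Y \<omega>"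
proof -
  obtain g :: "real \<Rightarrow> 'a" and s where g: "continuous_on UNIV g"
    and s [measurable]: "s \<in> borel_measurable borel" and s01: "\<And>x. 0 \<le> s x" "\<And>x. s x \<le> 1"
    and gs: "\<And>x. (\<And>b. b \<in> Basis \<Longrightarrow> 0 \<le> x \<bullet> b \<and> x \<bullet> b < 1) \<Longrightarrow> g (s x) = x"
    using continuous_curve_with_measurable_section by blast
  obtain B where B: "B > 0" "\<And>x. x \<in> K \<Longrightarrow> norm x < B"
    using K(1) by (auto simp: bounded_pos_less)
  define to_cube where "to_cube x = (1 / (2 * B)) *\<^sub>R x + (1/2) *\<^sub>R One" for x :: 'a
  define h where "h t = (2 * B) *\<^sub>R (g t - (1/2) *\<^sub>R One)" for t
  define u where "u x = s (to_cube x)" for x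
  have "continuous_on UNIV to_cube"
    unfolding to_cube_def by (intro continuous_intros)
  then have [measurable]: "to_cube \<in> borel_measurable borel"
    by (rule borel_measurable_continuous_onI)
  have u [measurable]: "u \<in> borel_measurable borel"
    unfolding u_def by measurable
  have h: "continuous_on UNIV h"
    unfolding h_def using g by (intro continuous_intros)
  then have h_meas [measurable]: "h \<in> borel_measurable borel"
    by (rule borel_measurable_continuous_onI)
  have hu: "h (u x) = x" if "x \<in> K" for x
  proof -
    have "0 \<le> to_cube x \<bullet> b \<and> to_cube x \<bullet> b < 1" if "b \<in> Basis" for b
    proof -
      have "\<bar>x \<bullet> b\<bar> < B" using B(2)[OF \<open>x \<in> K\<close>] Basis_le_norm[OF that, of x] by linarith
      then show ?thesis
        using that B(1) by (simp add: to_cube_def inner_add_left field_simps) linarith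
    qed
    then have "g (u x) = to_cube x" unfolding u_def by (rule gs)
    then show ?thesis using B(1) by (simp add: h_def to_cube_def)
  qed
  define \<mu> where "\<mu> n = distr (\<rho> n) borel u" for n
  have [measurable_cong]: "sets (\<rho> n) = sets borel" for n by (rule sets)
  have rd: "real_distribution (\<mu> n)" for n
  proof -
    interpret prob_space "\<rho> n" by (rule prob)
    show ?thesis unfolding \<mu>_def by (rule real_distribution_distr) measurable
  qed
  have "tight \<mu>"
    unfolding tight_def
  proof (intro conjI allI impI rd)
    fix \<epsilon> :: real assume "\<epsilon> > 0"
    have "measure (\<mu> n) {-1<..1} = 1" for n
    proof -
      interpret prob_space "\<rho> n" by (rule prob)
      have "measure (\<mu> n) {-1<..1} = measure (\<rho> n) (u -` {-1<..1} \<inter> space (\<rho> n))"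
        unfolding \<mu>_def by (rule measure_distr) auto
      also have "u -` {-1<..1} \<inter> space (\<rho> n) = space (\<rho> n)"
        using s01 less_le_trans[OF _ s01(1), of "-1"] by (auto simp: u_def)
      finally show ?thesis by (simp add: prob_space)
    qed
    then show "\<exists>a b. a < b \<and> (\<forall>n. 1 - \<epsilon> < measure (\<mu> n) {a<..b})"
      using \<open>\<epsilon> > 0\<close> by (intro exI[of _ "-1"] exI[of _ 1]) auto
  qed
  from tight_imp_convergent_subsubsequence[OF this strict_mono_id]
  obtain r M where r: "strict_mono (r :: nat \<Rightarrow> nat)" and M: "real_distribution M"
    and conv: "weak_conv_m (\<lambda>n. \<mu> (r n)) M" by (auto simp: comp_def)
  obtain \<Omega> :: "real measure" and X Y where \<Omega>: "prob_space \<Omega>"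
    and X [measurable]: "\<And>n. X n \<in> borel_measurable \<Omega>"
    and lawX: "\<And>n. distr \<Omega> borel (X n) = \<mu> (r n)"
    and Y_lborel: "Y \<in> measurable \<Omega> lborel"
    and lim: "\<And>\<omega>. \<omega> \<in> space \<Omega> \<Longrightarrow> (\<lambda>n. X n \<omega>) \<longlonglongrightarrow> Y \<omega>"
    using Skorohod[OF rd M conv] by blast
  have [measurable]: "Y \<in> borel_measurable \<Omega>" using Y_lborel by simp
  show ?thesis
  proof (rule that[OF r \<Omega>, of "\<lambda>n \<omega>. h (X n \<omega>)" "\<lambda>\<omega>. h (Y \<omega>)"])
    fix n
    have "distr \<Omega> borel (\<lambda>\<omega>. h (X n \<omega>)) = distr (\<mu> (r n)) borel h"
      unfolding lawX[symmetric] by (subst distr_distr) (auto simp: comp_def)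
    also have "\<dots> = distr (\<rho> (r n)) borel (\<lambda>x. h (u x))"
      unfolding \<mu>_def by (subst distr_distr) (auto simp: comp_def)
    also have "\<dots> = distr (\<rho> (r n)) borel (\<lambda>x. x)"
      by (rule distr_cong_AE) (use K(2)[of "r n"] hu in auto)
    also have "\<dots> = \<rho> (r n)"
      by (rule distr_id2) (rule sets[symmetric])
    finally show "distr \<Omega> borel (\<lambda>\<omega>. h (X n \<omega>)) = \<rho> (r n)" .
  next
    fix \<omega> assume "\<omega> \<in> space \<Omega>"
    then show "(\<lambda>n. h (X n \<omega>)) \<longlonglongrightarrow> h (Y \<omega>)"
      using h lim by (intro isCont_tendsto_compose[of _ h]) (auto simp: continuous_on_eq_continuous_at)
  qed (measurable)
qed

section \<open>Probability measures on a set and their interaction energy\<close>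

definition self_energy :: "('a::euclidean_space \<Rightarrow> ennreal) \<Rightarrow> 'a measure \<Rightarrow> ennreal" where
  "self_energy w \<rho> = (\<integral>\<^sup>+ x. \<integral>\<^sup>+ y. w (x - y) \<partial>\<rho> \<partial>\<rho>)"

definition borel_prob_on :: "(real ^ 'd) set \<Rightarrow> (real ^ 'd) measure set" where
  "borel_prob_on K = {\<rho> \<in> borel_prob. AE x in \<rho>. x \<in> K}"

definition minimizer_on :: "(real ^ 'd \<Rightarrow> ennreal) \<Rightarrow> (real ^ 'd) set \<Rightarrow> (real ^ 'd) measure \<Rightarrow> bool" where
  "minimizer_on w K \<rho> \<longleftrightarrow>
     \<rho> \<in> borel_prob_on K \<and> (\<forall>\<sigma>\<in>borel_prob_on K. self_energy w \<rho> \<le> self_energy w \<sigma>)"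

lemma borel_prob_onD:
  assumes "\<rho> \<in> borel_prob_on K"
  shows "prob_space \<rho>" "sets \<rho> = sets borel" "space \<rho> = UNIV" "AE x in \<rho>. x \<in> K"
  using assms sets_eq_imp_space_eq[of \<rho> borel] by (auto simp: borel_prob_on_def borel_prob_def)

lemma borel_prob_on_UNIV: "borel_prob_on UNIV = borel_prob"
  by (auto simp: borel_prob_on_def)

lemma borel_prob_on_mono: "K \<subseteq> K' \<Longrightarrow> borel_prob_on K \<subseteq> borel_prob_on K'"
  by (auto simp: borel_prob_on_def elim!: AE_mp)

lemma distr_borel_prob_on:
  assumes "prob_space M" "f \<in> borel_measurable M" "K \<in> sets borel" "AE x in M. f x \<in> K"
  shows "distr M borel f \<in> borel_prob_on K"
  using assms by (auto simp: borel_prob_on_def borel_prob_def AE_distr_iff prob_space.prob_space_distr)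

lemma uniform_measure_borel_prob_on:
  assumes "\<rho> \<in> borel_prob_on K" "A \<in> sets borel" "emeasure \<rho> A \<noteq> 0"
  shows "uniform_measure \<rho> A \<in> borel_prob_on K"
proof -
  interpret prob_space \<rho> using assms(1) by (rule borel_prob_onD)
  note [measurable_cong] = borel_prob_onD(2)[OF assms(1)]
  have "A \<in> sets \<rho>" using assms(2) borel_prob_onD(2)[OF assms(1)] by simp
  moreover have "prob_space (uniform_measure \<rho> A)"
    using assms(3) by (intro prob_space_uniform_measure) auto
  ultimately show ?thesis
    using borel_prob_onD(4)[OF assms(1)] borel_prob_onD(2)[OF assms(1)]
    by (auto simp: borel_prob_on_def borel_prob_def intro!: AE_uniform_measureI elim!: AE_mp)
qed

text \<open>
  By the Lindelof property, countably many balls of radius \<open>r\<close> cover the space, so they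
  cannot all be null.
\<close>

lemma ex_ball_measure_pos:
  fixes \<rho> :: "(real ^ 'd) measure"
  assumes \<rho>: "\<rho> \<in> borel_prob_on K" and "r > 0"
  obtains x where "measure \<rho> (ball x r) > 0"
proof (rule ccontr)
  interpret prob_space \<rho> using \<rho> by (rule borel_prob_onD)
  note sets = borel_prob_onD(2)[OF \<rho>] and space = borel_prob_onD(3)[OF \<rho>]
  assume "\<not> thesis"
  then have null: "ball x r \<in> null_sets \<rho>" for x
    using that[of x] sets measure_nonneg[of \<rho> "ball x r"]
    by (auto simp: null_sets_def emeasure_eq_measure less_le)
  obtain F where F: "F \<subseteq> range (\<lambda>x :: real ^ 'd. ball x r)" "countable F" "\<Union> F = (\<Union>x. ball x r)"
    using Lindelof[of "range (\<lambda>x :: real ^ 'd. ball x r)"] by auto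
  have "\<Union> F \<in> null_sets \<rho>"
  proof -
    have "(\<Union>S\<in>F. S) \<in> null_sets \<rho>"
      by (rule null_sets_UN'[OF F(2)]) (use F(1) null in blast)
    then show ?thesis by simp
  qed
  moreover have "\<Union> F = space \<rho>"
    unfolding F(3) space using centre_in_ball[of _ r] \<open>r > 0\<close> by blast
  ultimately show False using emeasure_space_1 by (simp add: null_sets_def)
qed

text \<open>
  Lower semicontinuity is stated through superlevel sets, which gives both Borel measurability and
  the inequality for limits of sequences that Fatou's lemma needs.
\<close>

locale lsc_kernel =
  fixes w :: "real ^ 'd \<Rightarrow> ennreal"
  assumes lsc: "open {x. a < w x}"
    and even: "w (- x) = w x"
begin

lemma measurable_w [measurable]: "w \<in> borel_measurable borel"
  by (rule borel_measurableI_greater) (simp add: lsc)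

lemma liminf_w:
  assumes "X \<longlonglongrightarrow> x"
  shows "w x \<le> liminf (\<lambda>n. w (X n))"
  unfolding le_Liminf_iff
proof safe
  fix a assume "a < w x"
  then show "\<forall>\<^sub>F n in sequentially. a < w (X n)"
    using topological_tendstoD[OF assms lsc[of a]] by simp
qed

lemma measurable_potential:
  assumes "\<rho> \<in> borel_prob_on K" and [measurable]: "B \<in> sets borel"
  shows "(\<lambda>x. \<integral>\<^sup>+ y. w (x - y) * indicator B y \<partial>\<rho>) \<in> borel_measurable borel"
proof -
  interpret prob_space \<rho> using assms(1) by (rule borel_prob_onD)
  note [measurable_cong] = borel_prob_onD(2)[OF assms(1)]
  show ?thesis by measurable
qed

definition cross_energy :: "(real ^ 'd) measure \<Rightarrow> (real ^ 'd) set \<Rightarrow> (real ^ 'd) set \<Rightarrow> ennreal" where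
  "cross_energy \<rho> A B = (\<integral>\<^sup>+ x. (\<integral>\<^sup>+ y. w (x - y) * indicator B y \<partial>\<rho>) * indicator A x \<partial>\<rho>)"

lemma cross_energy_UNIV: "cross_energy \<rho> UNIV UNIV = self_energy w \<rho>"
  by (simp add: cross_energy_def self_energy_def)

lemma cross_energy_commute:
  assumes \<rho>: "\<rho> \<in> borel_prob_on K" and [measurable]: "A \<in> sets borel" "B \<in> sets borel"
  shows "cross_energy \<rho> A B = cross_energy \<rho> B A"
proof -
  interpret prob_space \<rho> using \<rho> by (rule borel_prob_onD)
  note [measurable_cong] = borel_prob_onD(2)[OF \<rho>]
  interpret pair_sigma_finite \<rho> \<rho> by standard
  have "cross_energy \<rho> A B = (\<integral>\<^sup>+ x. \<integral>\<^sup>+ y. w (x - y) * indicator B y * indicator A x \<partial>\<rho> \<partial>\<rho>)"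
    unfolding cross_energy_def by (intro nn_integral_cong nn_integral_multc[symmetric]) measurable
  also have "\<dots> = (\<integral>\<^sup>+ y. \<integral>\<^sup>+ x. w (x - y) * indicator B y * indicator A x \<partial>\<rho> \<partial>\<rho>)"
    by (rule Fubini') measurable
  also have "\<dots> = (\<integral>\<^sup>+ y. \<integral>\<^sup>+ x. w (y - x) * indicator A x * indicator B y \<partial>\<rho> \<partial>\<rho>)"
    using even[of "x - y" for x y] by (intro nn_integral_cong) (simp add: mult_ac)
  also have "\<dots> = cross_energy \<rho> B A"
    unfolding cross_energy_def by (intro nn_integral_cong nn_integral_multc) measurable
  finally show ?thesis .
qed

text \<open>
  Additivity in the second argument; with the symmetry of the kernel it yields the expansion of the
  quadratic form along a set and its complement.
\<close>

lemma cross_energy_split_right: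
  assumes \<rho>: "\<rho> \<in> borel_prob_on K" and [measurable]: "A \<in> sets borel" "B \<in> sets borel"
  shows "cross_energy \<rho> A UNIV = cross_energy \<rho> A B + cross_energy \<rho> A (- B)"
proof -
  note [measurable_cong] = borel_prob_onD(2)[OF \<rho>]
  note [measurable] = measurable_potential[OF \<rho>]
  have "(\<integral>\<^sup>+ y. w (x - y) * indicator UNIV y \<partial>\<rho>)
      = (\<integral>\<^sup>+ y. w (x - y) * indicator B y \<partial>\<rho>) + (\<integral>\<^sup>+ y. w (x - y) * indicator (- B) y \<partial>\<rho>)" for x
    by (subst nn_integral_add[symmetric]) (auto intro!: nn_integral_cong simp: indicator_def)
  then show ?thesis
    unfolding cross_energy_def by (simp add: distrib_right nn_integral_add)
qed

lemma cross_energy_split: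
  assumes \<rho>: "\<rho> \<in> borel_prob_on K" and A: "A \<in> sets borel"
  shows "self_energy w \<rho> = cross_energy \<rho> A A + cross_energy \<rho> (- A) (- A) + 2 * cross_energy \<rho> A (- A)"
proof -
  have nA: "- A \<in> sets borel" using A by auto
  have "self_energy w \<rho> = cross_energy \<rho> UNIV A + cross_energy \<rho> UNIV (- A)"
    using cross_energy_split_right[OF \<rho>, of UNIV A] A by (simp add: cross_energy_UNIV)
  also have "\<dots> = cross_energy \<rho> A UNIV + cross_energy \<rho> (- A) UNIV"
    using cross_energy_commute[OF \<rho>, of UNIV] A nA by simp
  also have "\<dots> = cross_energy \<rho> A A + cross_energy \<rho> A (- A)
      + (cross_energy \<rho> (- A) A + cross_energy \<rho> (- A) (- A))"
    using cross_energy_split_right[OF \<rho>, of _ A] A nA by simp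
  also have "cross_energy \<rho> (- A) A = cross_energy \<rho> A (- A)"
    by (rule cross_energy_commute[OF \<rho> nA A])
  finally show ?thesis by (simp add: mult_2 ac_simps)
qed

lemma self_energy_uniform_measure:
  assumes \<rho>: "\<rho> \<in> borel_prob_on K" and [measurable]: "A \<in> sets borel"
  shows "self_energy w (uniform_measure \<rho> A) = cross_energy \<rho> A A / (emeasure \<rho> A)\<^sup>2"
proof -
  note [measurable_cong] = borel_prob_onD(2)[OF \<rho>]
  note [measurable] = measurable_potential[OF \<rho>]
  have A: "A \<in> sets \<rho>" by measurable
  define V where "V x = (\<integral>\<^sup>+ y. w (x - y) * indicator A y \<partial>\<rho>)" for x
  have [measurable]: "V \<in> borel_measurable borel" unfolding V_def by measurable
  have "self_energy w (uniform_measure \<rho> A) = (\<integral>\<^sup>+ x. V x / emeasure \<rho> A \<partial>uniform_measure \<rho> A)"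
    unfolding self_energy_def V_def using A
    by (intro nn_integral_cong nn_integral_uniform_measure) measurable
  also have "\<dots> = (\<integral>\<^sup>+ x. V x / emeasure \<rho> A * indicator A x \<partial>\<rho>) / emeasure \<rho> A"
    using A by (intro nn_integral_uniform_measure) measurable
  also have "(\<integral>\<^sup>+ x. V x / emeasure \<rho> A * indicator A x \<partial>\<rho>)
      = (\<integral>\<^sup>+ x. (V x * indicator A x) * inverse (emeasure \<rho> A) \<partial>\<rho>)"
    by (simp add: divide_ennreal_def mult_ac)
  also have "\<dots> = cross_energy \<rho> A A / emeasure \<rho> A"
    unfolding cross_energy_def divide_ennreal_def V_def[symmetric]
    by (rule nn_integral_multc) measurable
  also have "cross_energy \<rho> A A / emeasure \<rho> A / emeasure \<rho> A = cross_energy \<rho> A A / (emeasure \<rho> A)\<^sup>2"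
    using finite_measure.emeasure_finite[OF prob_space.finite_measure[OF borel_prob_onD(1)[OF \<rho>]], of A]
    by (simp add: divide_ennreal_def power2_eq_square ennreal_inverse_mult mult.assoc less_top)
  finally show ?thesis .
qed

subsection \<open>Concentration of minimizers\<close>

text \<open>
  Write \<open>a = \<rho>(A)\<close>. The normalized restrictions of \<open>\<rho>\<close> to \<open>A\<close> and to \<open>- A\<close> are competitors,
  so the diagonal parts of the energy are at least \<open>a\<^sup>2 q\<close> and \<open>(1 - a)\<^sup>2 q\<close>. As the total is \<open>q\<close>,
  what is left for the two equal off-diagonal parts is at most \<open>2 a (1 - a) q\<close>.
\<close>

lemma minimizer_cross_energy_le:
  assumes min: "minimizer_on w K \<rho>" and fin: "self_energy w \<rho> = ennreal q" "0 \<le> q"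
    and A [measurable]: "A \<in> sets borel"
  shows "cross_energy \<rho> A (- A) \<le> ennreal (measure \<rho> A * (1 - measure \<rho> A) * q)"
proof -
  have \<rho>: "\<rho> \<in> borel_prob_on K" using min by (simp add: minimizer_on_def)
  interpret prob_space \<rho> using \<rho> by (rule borel_prob_onD)
  note sets = borel_prob_onD(2)[OF \<rho>] and space = borel_prob_onD(3)[OF \<rho>]
  have diag: "ennreal ((measure \<rho> S)\<^sup>2 * q) \<le> cross_energy \<rho> S S" if S: "S \<in> sets borel" for S
  proof (cases "emeasure \<rho> S = 0")
    case True
    then show ?thesis by (simp add: measure_def)
  next
    case False
    have "ennreal q \<le> self_energy w (uniform_measure \<rho> S)"
      using uniform_measure_borel_prob_on[OF \<rho> S False] min fin by (auto simp: minimizer_on_def)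
    then have "ennreal q * (emeasure \<rho> S)\<^sup>2 \<le> cross_energy \<rho> S S / (emeasure \<rho> S)\<^sup>2 * (emeasure \<rho> S)\<^sup>2"
      unfolding self_energy_uniform_measure[OF \<rho> S] by (rule mult_right_mono) simp
    also have "\<dots> = cross_energy \<rho> S S"
      using False by (simp add: ennreal_divide_times ennreal_times_divide ennreal_mult_divide_eq power2_eq_square ennreal_mult_eq_top_iff)
    finally show ?thesis
      using fin(2) by (simp add: emeasure_eq_measure ennreal_mult ennreal_power[symmetric] mult.commute)
  qed
  have compl: "measure \<rho> (- A) = 1 - measure \<rho> A"
    using prob_compl[of A] sets A space by (simp add: Compl_eq_Diff_UNIV)
  define a where "a = measure \<rho> A"
  have a: "0 \<le> a" "a \<le> 1" by (auto simp: a_def)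
  have eq: "ennreal q = cross_energy \<rho> A A + cross_energy \<rho> (- A) (- A) + 2 * cross_energy \<rho> A (- A)"
    using cross_energy_split[OF \<rho> A] fin by simp
  then have le: "2 * cross_energy \<rho> A (- A) \<le> ennreal q" by simp
  have "cross_energy \<rho> A (- A) \<noteq> \<top>"
    using le by (auto simp: ennreal_mult_eq_top_iff top_unique)
  then obtain x where x: "cross_energy \<rho> A (- A) = ennreal x" "0 \<le> x"
    by (cases "cross_energy \<rho> A (- A)") auto
  have "ennreal (a\<^sup>2 * q) + ennreal ((1 - a)\<^sup>2 * q) + 2 * ennreal x \<le> ennreal q"
    unfolding eq x(1)[symmetric] using diag[OF A] diag[of "- A"] compl
    by (intro add_mono) (auto simp: a_def)
  also have "ennreal (a\<^sup>2 * q) + ennreal ((1 - a)\<^sup>2 * q) + 2 * ennreal x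
      = ennreal (a\<^sup>2 * q + (1 - a)\<^sup>2 * q + 2 * x)"
    using fin(2) x(2) by (simp add: ennreal_plus ennreal_mult)
  finally have "a\<^sup>2 * q + (1 - a)\<^sup>2 * q + 2 * x \<le> q"
    using fin(2) by simp
  then have "x \<le> a * (1 - a) * q"
    by (simp add: power2_eq_square algebra_simps)
  then show ?thesis unfolding x a_def by (rule ennreal_leI)
qed

text \<open>
  Each point of \<open>A\<close> interacts with the distant set \<open>B\<close>, which lies in \<open>- A\<close>, at cost at least \<open>c\<close>; the upper
  bound on the cross energy of \<open>A\<close> and \<open>- A\<close> does the rest after division by the mass of \<open>A\<close>.
\<close>

lemma minimizer_separated:
  assumes min: "minimizer_on w K \<rho>" and q: "self_energy w \<rho> \<le> ennreal q" "0 \<le> q"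
    and far: "\<And>z. norm z \<ge> r \<Longrightarrow> ennreal c \<le> w z" "0 < r" "0 \<le> c"
    and meas: "A \<in> sets borel" "B \<in> sets borel"
    and sep: "\<And>x y. x \<in> A \<Longrightarrow> y \<in> B \<Longrightarrow> r \<le> dist x y" and A: "measure \<rho> A > 0"
  shows "c * measure \<rho> B \<le> q * (1 - measure \<rho> A)"
proof -
  have \<rho>: "\<rho> \<in> borel_prob_on K" using min by (simp add: minimizer_on_def)
  interpret prob_space \<rho> using \<rho> by (rule borel_prob_onD)
  note sets [measurable_cong] = borel_prob_onD(2)[OF \<rho>]
  note [measurable] = meas
  obtain q' where q': "self_energy w \<rho> = ennreal q'" "0 \<le> q'" "q' \<le> q"
    using q by (cases "self_energy w \<rho>") (auto simp: top_unique)
  have "ennreal (c * measure \<rho> B * measure \<rho> A)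
      = (\<integral>\<^sup>+ x. ennreal (c * measure \<rho> B) * indicator A x \<partial>\<rho>)"
    using far by (simp add: nn_integral_cmult emeasure_eq_measure ennreal_mult[symmetric])
  also have "\<dots> \<le> cross_energy \<rho> A (- A)"
    unfolding cross_energy_def
  proof (intro nn_integral_mono)
    fix x
    show "ennreal (c * measure \<rho> B) * indicator A x
        \<le> (\<integral>\<^sup>+ y. w (x - y) * indicator (- A) y \<partial>\<rho>) * indicator A x"
    proof (cases "x \<in> A")
      case True
      have "ennreal (c * measure \<rho> B) = (\<integral>\<^sup>+ y. ennreal c * indicator B y \<partial>\<rho>)"
        using far by (simp add: nn_integral_cmult emeasure_eq_measure ennreal_mult[symmetric])
      also have "\<dots> \<le> (\<integral>\<^sup>+ y. w (x - y) * indicator (- A) y \<partial>\<rho>)"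
      proof (intro nn_integral_mono)
        fix y
        have "y \<notin> A" if "y \<in> B" using sep[of y y] that far(2) by auto
        then show "ennreal c * indicator B y \<le> w (x - y) * indicator (- A) y"
          using far(1)[of "x - y"] sep[OF True, of y] by (auto simp: indicator_def dist_norm)
      qed
      finally show ?thesis using True by simp
    qed simp
  qed
  also have "\<dots> \<le> ennreal (measure \<rho> A * (1 - measure \<rho> A) * q')"
    by (rule minimizer_cross_energy_le[OF min q'(1,2) meas(1)])
  finally have "c * measure \<rho> B * measure \<rho> A \<le> measure \<rho> A * (1 - measure \<rho> A) * q'"
    using q'(2) by (subst (asm) ennreal_le_iff) auto
  then have "measure \<rho> A * (c * measure \<rho> B) \<le> measure \<rho> A * (q' * (1 - measure \<rho> A))"
    by (simp add: mult_ac)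
  then have "c * measure \<rho> B \<le> q' * (1 - measure \<rho> A)"
    using A by (rule mult_left_le_imp_le)
  also have "\<dots> \<le> q * (1 - measure \<rho> A)"
    using q'(3) by (intro mult_right_mono) auto
  finally show ?thesis .
qed

text \<open>
  That \<open>D\<close> does not depend on the constraint set \<open>K\<close> is what makes the passage from balls to the
  whole space possible. The two roles of a ball and a distant exterior give two
  inequalities: \<open>outer\<close> makes the ball of radius \<open>2 r\<close> heavy, and \<open>inner\<close> makes the mass grow by the
  factor \<open>1 / \<theta>\<close> over each further distance \<open>r\<close> until the ball has full mass.
\<close>

lemma minimizer_concentration_radius:
  assumes far: "\<And>z. norm z \<ge> r \<Longrightarrow> ennreal c \<le> w z" "0 < r" and q: "0 \<le> q" "q < c"
  shows "\<exists>D>0. \<forall>K \<rho> x. minimizer_on w K \<rho> \<longrightarrow> self_energy w \<rho> \<le> ennreal q \<longrightarrow>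
    measure \<rho> (ball x r) > 0 \<longrightarrow> (AE y in \<rho>. y \<in> ball x D)"
proof -
  define \<theta> where "\<theta> = q / c"
  have \<theta>: "0 \<le> \<theta>" "\<theta> < 1" using q by (auto simp: \<theta>_def)
  obtain k where k: "\<theta> ^ k < 1 - \<theta>"
    using real_arch_pow_inv[of "1 - \<theta>" \<theta>] \<theta> by auto
  have "AE y in \<rho>. y \<in> ball x ((k + 2) * r)"
    if min: "minimizer_on w K \<rho>" and le: "self_energy w \<rho> \<le> ennreal q"
      and pos: "measure \<rho> (ball x r) > 0" for K \<rho> x
  proof -
    have \<rho>: "\<rho> \<in> borel_prob_on K" using min by (simp add: minimizer_on_def)
    interpret prob_space \<rho> using \<rho> by (rule borel_prob_onD)
    note sets [measurable_cong] = borel_prob_onD(2)[OF \<rho>] and space = borel_prob_onD(3)[OF \<rho>]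
    define m where "m t = measure \<rho> (ball x t)" for t
    have compl: "measure \<rho> (- ball x t) = 1 - m t" for t
      using prob_compl[of "ball x t"] sets space by (simp add: Compl_eq_Diff_UNIV m_def)
    have m_mono: "m s \<le> m t" if "s \<le> t" for s t
      unfolding m_def using that sets by (intro finite_measure_mono) auto
    have m_le: "m t \<le> 1" for t by (simp add: m_def)
    have sep: "r \<le> dist y z" if "y \<in> ball x t" "z \<in> - ball x (t + r)" for y z t
      using that dist_triangle[of x z y] by (auto simp: dist_commute)
    have sep': "r \<le> dist z y" if "z \<in> - ball x (t + r)" "y \<in> ball x t" for y z t
      using sep[OF that(2,1)] by (simp add: dist_commute)
    have outer: "1 - m (t + r) \<le> \<theta> * (1 - m t)" if "m t > 0" for t
      using minimizer_separated[OF min le q(1) far, of "ball x t" "- ball x (t + r)"] sep that q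
      unfolding compl m_def[symmetric] \<theta>_def by (simp add: field_simps)
    have inner: "m t \<le> \<theta> * m (t + r)" if "m (t + r) < 1" for t
      using minimizer_separated[OF min le q(1) far, of "- ball x (t + r)" "ball x t", OF _ _ _ _ sep'] that q
      unfolding compl m_def[symmetric] \<theta>_def by (simp add: field_simps)
    have "m ((k + 2) * r) = 1"
    proof (rule ccontr)
      assume "m ((k + 2) * r) \<noteq> 1"
      then have lt: "m ((k + 2) * r) < 1" using m_le[of "(k + 2) * r"] by simp
      have "m (2 * r) \<le> \<theta> ^ j * m ((j + 2) * r)" if "j \<le> k" for j
        using that
      proof (induction j)
        case (Suc j)
        have "real (Suc j) * r \<le> real k * r"
          using Suc.prems far(2) by (intro mult_right_mono) auto
        then have "m (real (j + 2) * r + r) < 1"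
          by (intro le_less_trans[OF m_mono lt]) (simp add: algebra_simps)
        from inner[OF this] have "m (real (j + 2) * r) \<le> \<theta> * m (real (Suc j + 2) * r)"
          by (simp add: algebra_simps)
        then have "\<theta> ^ j * m (real (j + 2) * r) \<le> \<theta> ^ j * (\<theta> * m (real (Suc j + 2) * r))"
          using \<theta> by (intro mult_left_mono) auto
        with Suc show ?case by (simp add: mult_ac add_ac)
      qed simp
      from this[of k] have "m (2 * r) \<le> \<theta> ^ k * m ((k + 2) * r)" by (simp add: add.commute)
      also have "\<dots> \<le> \<theta> ^ k" using \<theta> m_le by (simp add: mult_left_le)
      also have "\<dots> < 1 - \<theta>" by (rule k)
      finally have "m (2 * r) < 1 - \<theta>" .
      moreover have "1 - m (r + r) \<le> \<theta> * (1 - m r)"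
        using pos by (intro outer) (simp add: m_def)
      moreover have "\<theta> * (1 - m r) \<le> \<theta>"
        using \<theta> by (intro mult_left_le) (auto simp: m_def)
      ultimately show False by (simp only: mult_2)
    qed
    moreover have "ball x ((k + 2) * r) \<in> events" by (simp add: sets)
    ultimately show ?thesis unfolding m_def using prob_eq_1[of "ball x ((k + 2) * r)"] by metis
  qed
  then have "\<forall>K \<rho> x. minimizer_on w K \<rho> \<longrightarrow> self_energy w \<rho> \<le> ennreal q \<longrightarrow>
    measure \<rho> (ball x r) > 0 \<longrightarrow> (AE y in \<rho>. y \<in> ball x ((k + 2) * r))"
    by (intro allI impI)
  moreover have "0 < real (k + 2) * r" using far(2) by simp
  ultimately show ?thesis by (intro exI[of _ "real (k + 2) * r"] conjI)
qed

subsection \<open>Existence of minimizers\<close>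

lemma self_energy_translate:
  assumes \<rho>: "\<rho> \<in> borel_prob_on K"
  shows "self_energy w (distr \<rho> borel (\<lambda>x. x - a)) = self_energy w \<rho>"
proof -
  note [measurable_cong] = borel_prob_onD(2)[OF \<rho>]
  have \<sigma>: "distr \<rho> borel (\<lambda>x. x - a) \<in> borel_prob_on UNIV"
    using borel_prob_onD(1)[OF \<rho>] by (intro distr_borel_prob_on) auto
  show ?thesis
    unfolding self_energy_def using measurable_potential[OF \<sigma>, of UNIV]
    by (simp add: nn_integral_distr)
qed

text \<open>
  The direct method: the random vectors converge pointwise, so lower semicontinuity of the
  kernel and two applications of Fatou's lemma bound the energy of the limit law by the infimum.
\<close>

lemma ex_minimizer_on_compact:
  assumes K: "compact K" "K \<noteq> {}"
  obtains \<rho> where "minimizer_on w K \<rho>"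
proof -
  have "\<exists>\<rho>. \<rho> \<in> borel_prob_on K"
  proof -
    obtain x where "x \<in> K" using K(2) by auto
    have [measurable]: "K \<in> sets borel" using K(1) by (simp add: borel_compact)
    have "Measurable.pred borel (\<lambda>x. x \<in> K)" by measurable
    then have "return borel x \<in> borel_prob_on K"
      using \<open>x \<in> K\<close> by (simp add: borel_prob_on_def borel_prob_def prob_space_return AE_return)
    then show ?thesis ..
  qed
  then have "self_energy w ` borel_prob_on K \<noteq> {}" by auto
  from ennreal_Inf_countable_INF[OF this]
  obtain f :: "nat \<Rightarrow> ennreal" where f: "decseq f" "range f \<subseteq> self_energy w ` borel_prob_on K"
    "Inf (self_energy w ` borel_prob_on K) = (INF i. f i)" by blast
  define q where "q = Inf (self_energy w ` borel_prob_on K)"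
  have lim: "f \<longlonglongrightarrow> q" unfolding q_def f(3) by (rule LIMSEQ_INF[OF f(1)])
  have "\<forall>n. \<exists>\<rho>. \<rho> \<in> borel_prob_on K \<and> f n = self_energy w \<rho>" using f(2) by blast
  then obtain \<rho> where \<rho>: "\<And>n. \<rho> n \<in> borel_prob_on K" and f_eq: "\<And>n. f n = self_energy w (\<rho> n)"
    by metis
  obtain r :: "nat \<Rightarrow> nat" and \<Omega> :: "real measure" and X Y where r: "strict_mono r"
    and \<Omega>: "prob_space \<Omega>"
    and X [measurable]: "\<And>n. X n \<in> borel_measurable \<Omega>" and Y [measurable]: "Y \<in> borel_measurable \<Omega>"
    and law: "\<And>n. distr \<Omega> borel (X n) = \<rho> (r n)"
    and conv: "\<And>\<omega>. \<omega> \<in> space \<Omega> \<Longrightarrow> (\<lambda>n. X n \<omega>) \<longlonglongrightarrow> Y \<omega>"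
    by (rule bounded_imp_subseq_Skorohod[of \<rho> K, OF borel_prob_onD(1,2)[OF \<rho>] compact_imp_bounded[OF K(1)]
          borel_prob_onD(4)[OF \<rho>]]) (rule that)
  interpret \<Omega>: prob_space \<Omega> by (rule \<Omega>)
  have K_borel: "K \<in> sets borel" using K(1) by (simp add: borel_compact)
  have self: "self_energy w (distr \<Omega> borel Z) = (\<integral>\<^sup>+ \<omega>. \<integral>\<^sup>+ \<omega>'. w (Z \<omega> - Z \<omega>') \<partial>\<Omega> \<partial>\<Omega>)"
    if [measurable]: "Z \<in> borel_measurable \<Omega>" for Z
  proof -
    have "distr \<Omega> borel Z \<in> borel_prob_on UNIV"
      using \<Omega> by (intro distr_borel_prob_on) auto
    from measurable_potential[OF this, of UNIV] show ?thesis
      unfolding self_energy_def by (simp add: nn_integral_distr)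
  qed
  have "AE \<omega> in \<Omega>. X n \<omega> \<in> K" for n
    using borel_prob_onD(4)[OF \<rho>[of "r n"]] K_borel unfolding law[symmetric]
    by (subst (asm) AE_distr_iff) auto
  then have "AE \<omega> in \<Omega>. \<forall>n. X n \<omega> \<in> K" by (simp add: AE_all_countable)
  then have "AE \<omega> in \<Omega>. Y \<omega> \<in> K"
    using AE_space
  proof eventually_elim
    case (elim \<omega>)
    with closed_sequentially[OF compact_imp_closed[OF K(1)], of "\<lambda>n. X n \<omega>" "Y \<omega>"] conv[of \<omega>]
    show ?case by auto
  qed
  then have limit_in: "distr \<Omega> borel Y \<in> borel_prob_on K"
    using \<Omega> K_borel by (intro distr_borel_prob_on) auto
  have "self_energy w (distr \<Omega> borel Y) = (\<integral>\<^sup>+ \<omega>. \<integral>\<^sup>+ \<omega>'. w (Y \<omega> - Y \<omega>') \<partial>\<Omega> \<partial>\<Omega>)"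
    by (rule self) measurable
  also have "\<dots> \<le> (\<integral>\<^sup>+ \<omega>. \<integral>\<^sup>+ \<omega>'. liminf (\<lambda>n. w (X n \<omega> - X n \<omega>')) \<partial>\<Omega> \<partial>\<Omega>)"
    by (intro nn_integral_mono liminf_w tendsto_diff conv)
  also have "\<dots> \<le> (\<integral>\<^sup>+ \<omega>. liminf (\<lambda>n. \<integral>\<^sup>+ \<omega>'. w (X n \<omega> - X n \<omega>') \<partial>\<Omega>) \<partial>\<Omega>)"
    by (intro nn_integral_mono nn_integral_liminf) measurable
  also have "\<dots> \<le> liminf (\<lambda>n. \<integral>\<^sup>+ \<omega>. \<integral>\<^sup>+ \<omega>'. w (X n \<omega> - X n \<omega>') \<partial>\<Omega> \<partial>\<Omega>)"
    by (intro nn_integral_liminf) measurable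
  also have "\<dots> = liminf (\<lambda>n. f (r n))"
    unfolding f_eq law[symmetric] by (subst self) auto
  also have "\<dots> = q"
    using LIMSEQ_subseq_LIMSEQ[OF lim r] by (intro lim_imp_Liminf) (auto simp: comp_def)
  finally have "self_energy w (distr \<Omega> borel Y) \<le> q" .
  then have "minimizer_on w K (distr \<Omega> borel Y)"
    using limit_in unfolding minimizer_on_def q_def by (auto intro: order_trans[OF _ Inf_lower])
  then show ?thesis by (rule that)
qed

text \<open>
  Restricting to a ball lowers the double integral because the kernel is nonnegative, and the
  normalizing factor tends to \<open>1\<close> as the ball grows.
\<close>

lemma ex_truncation_energy_less:
  assumes \<sigma>: "\<sigma> \<in> borel_prob" and less: "self_energy w \<sigma> < b"
  obtains n :: nat and \<tau> where "\<tau> \<in> borel_prob_on (cball 0 n)" "self_energy w \<tau> < b"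
proof -
  have \<sigma>U: "\<sigma> \<in> borel_prob_on UNIV" using \<sigma> by (simp add: borel_prob_on_UNIV)
  interpret prob_space \<sigma> using \<sigma>U by (rule borel_prob_onD)
  note sets = borel_prob_onD(2)[OF \<sigma>U] and space = borel_prob_onD(3)[OF \<sigma>U]
  define m where "m n = measure \<sigma> (cball 0 (real n))" for n
  have inc: "incseq (\<lambda>n. cball (0 :: real ^ 'd) (real n))"
    by (intro incseq_SucI subset_cball) simp
  have "(\<Union>n. cball 0 (real n)) = (UNIV :: (real ^ 'd) set)"
    by (auto intro: real_arch_simple)
  then have m1: "m \<longlonglongrightarrow> 1"
    unfolding m_def using finite_Lim_measure_incseq[of "\<lambda>n. cball 0 (real n)"] inc sets prob_space space
    by (simp add: image_subset_iff)
  define U where "U n = uniform_measure \<sigma> (cball 0 (real n))" for n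
  have bound: "self_energy w (U n) \<le> self_energy w \<sigma> / (ennreal (m n))\<^sup>2" for n
  proof -
    have "cross_energy \<sigma> (cball 0 (real n)) (cball 0 (real n)) \<le> cross_energy \<sigma> UNIV UNIV"
      unfolding cross_energy_def by (intro nn_integral_mono mult_mono) (auto simp: indicator_def)
    then show ?thesis
      unfolding U_def self_energy_uniform_measure[OF \<sigma>U borel_closed[OF closed_cball]]
      by (auto simp: cross_energy_UNIV m_def emeasure_eq_measure intro: divide_right_mono_ennreal)
  qed
  obtain x where x: "self_energy w \<sigma> = ennreal x" "0 \<le> x"
    using less by (cases "self_energy w \<sigma>") auto
  have "(\<lambda>n. ennreal (x / (m n)\<^sup>2)) \<longlonglongrightarrow> ennreal (x / 1\<^sup>2)"
    by (intro tendsto_intros m1) simp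
  then have "\<forall>\<^sub>F n in sequentially. ennreal (x / (m n)\<^sup>2) < b"
    using less x by (intro order_tendstoD(2)) auto
  moreover have "\<forall>\<^sub>F n in sequentially. 0 < m n"
    using m1 by (rule order_tendstoD) simp
  ultimately have "\<forall>\<^sub>F n in sequentially. ennreal (x / (m n)\<^sup>2) < b \<and> 0 < m n"
    by eventually_elim simp
  then obtain n where n: "ennreal (x / (m n)\<^sup>2) < b" "0 < m n"
    using eventually_happens'[OF sequentially_bot] by blast
  have "self_energy w (U n) < b"
    using bound[of n] n x by (simp add: divide_ennreal[symmetric] ennreal_power[symmetric])
  moreover have "U n \<in> borel_prob"
    using uniform_measure_borel_prob_on[OF \<sigma>U, of "cball 0 (real n)"] n(2)
    by (simp add: U_def m_def emeasure_eq_measure borel_prob_on_UNIV)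
  moreover have "AE x in U n. x \<in> cball 0 (real n)"
    unfolding U_def by (rule AE_uniform_measureI) (simp_all add: sets)
  ultimately show ?thesis by (intro that[of "U n" n]) (simp_all add: borel_prob_on_def)
qed

lemma ex_minimizer_radius:
  assumes lim: "(w \<longlongrightarrow> L) at_infinity" and q: "ennreal q < L" "0 \<le> q"
  shows "\<exists>r>0. \<exists>D>0. \<forall>K \<rho> x. minimizer_on w K \<rho> \<longrightarrow> self_energy w \<rho> \<le> ennreal q \<longrightarrow>
    measure \<rho> (ball x r) > 0 \<longrightarrow> (AE y in \<rho>. y \<in> ball x D)"
proof -
  obtain c' where c': "ennreal q < c'" "c' < L" using dense[OF q(1)] by blast
  then obtain c where c: "c' = ennreal c" "q < c" using q(2) by (cases c') (auto simp: ennreal_less_iff)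
  obtain r where r: "r > 0" "\<And>z. norm z \<ge> r \<Longrightarrow> c' < w z"
    using order_tendstoD(1)[OF lim c'(2)] unfolding eventually_at_infinity_pos by blast
  have far: "ennreal c \<le> w z" if "norm z \<ge> r" for z
    using r(2)[OF that] c(1) by simp
  have "\<exists>D>0. \<forall>K \<rho> x. minimizer_on w K \<rho> \<longrightarrow> self_energy w \<rho> \<le> ennreal q \<longrightarrow>
    measure \<rho> (ball x r) > 0 \<longrightarrow> (AE y in \<rho>. y \<in> ball x D)"
    by (rule minimizer_concentration_radius) (fact far r(1) q(2) c(2))+
  then show ?thesis
    by - (rule exI[of _ r], rule conjI, rule r(1))
qed

text \<open>
  The candidate is a minimizer on a ball of radius \<open>N \<ge> D\<close>. A better measure could be truncated to
  some larger ball; the minimizer on that ball would be better still, and it would be concentrated on a ball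
  of radius \<open>D\<close>, hence a translate of it would compete on the ball of radius \<open>N\<close>.
\<close>

theorem ex_minimizer:
  assumes lim: "(w \<longlongrightarrow> L) at_infinity" and \<sigma>: "\<sigma> \<in> borel_prob" "self_energy w \<sigma> < L"
  obtains \<rho> where "minimizer_on w UNIV \<rho>"
proof -
  obtain q' where q': "self_energy w \<sigma> < q'" "q' < L" using dense[OF \<sigma>(2)] by blast
  then obtain q where q: "q' = ennreal q" "0 \<le> q" by (cases q') auto
  obtain r D where r: "r > 0" "D > 0" and conc:
    "\<And>K \<rho> x. minimizer_on w K \<rho> \<Longrightarrow> self_energy w \<rho> \<le> ennreal q \<Longrightarrow> measure \<rho> (ball x r) > 0
       \<Longrightarrow> AE y in \<rho>. y \<in> ball x D"
    using ex_minimizer_radius[OF lim, of q] q q' by blast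
  obtain n0 :: nat and \<tau>0 where \<tau>0: "\<tau>0 \<in> borel_prob_on (cball 0 n0)" "self_energy w \<tau>0 < q'"
    using ex_truncation_energy_less[OF \<sigma>(1) q'(1)] .
  define N where "N = nat \<lceil>D\<rceil>"
  have N: "D \<le> N" unfolding N_def by linarith
  obtain \<rho> where \<rho>: "minimizer_on w (cball 0 (real N)) \<rho>"
    using ex_minimizer_on_compact[of "cball 0 (real N)"] by auto
  have "self_energy w \<rho> \<le> self_energy w \<tau>" if \<tau>: "\<tau> \<in> borel_prob" for \<tau>
  proof (rule ccontr)
    assume "\<not> self_energy w \<rho> \<le> self_energy w \<tau>"
    then have less: "self_energy w \<tau> < self_energy w \<rho>" by simp
    obtain n :: nat and \<tau>'
      where \<tau>': "\<tau>' \<in> borel_prob_on (cball 0 n)" "self_energy w \<tau>' < self_energy w \<rho>"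
      using ex_truncation_energy_less[OF \<tau> less] .
    \<comment> \<open>The larger ball also carries a truncation of \<open>\<sigma>\<close>, which keeps the energy of its
      minimizer at most \<open>q\<close>, as the concentration radius \<open>D\<close> demands.\<close>
    define n' where "n' = max n n0"
    obtain \<rho>' where \<rho>': "minimizer_on w (cball 0 (real n')) \<rho>'"
      using ex_minimizer_on_compact[of "cball 0 (real n')"] by auto
    have \<rho>'_in: "\<rho>' \<in> borel_prob_on (cball 0 (real n'))" using \<rho>' by (simp add: minimizer_on_def)
    have sub: "borel_prob_on (cball 0 (real n)) \<subseteq> borel_prob_on (cball (0 :: real ^ 'd) (real n'))"
      "borel_prob_on (cball 0 (real n0)) \<subseteq> borel_prob_on (cball (0 :: real ^ 'd) (real n'))"
      unfolding n'_def by (rule borel_prob_on_mono, simp add: subset_cball)+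
    have "\<tau>' \<in> borel_prob_on (cball 0 (real n'))" "\<tau>0 \<in> borel_prob_on (cball 0 (real n'))"
      using \<tau>'(1) \<tau>0(1) sub by blast+
    then have "self_energy w \<rho>' \<le> self_energy w \<tau>'" "self_energy w \<rho>' \<le> self_energy w \<tau>0"
      using \<rho>' unfolding minimizer_on_def by blast+
    then have \<rho>'_le: "self_energy w \<rho>' \<le> self_energy w \<tau>'" "self_energy w \<rho>' \<le> ennreal q"
      using \<tau>0(2) q(1) by simp_all
    obtain x where x: "measure \<rho>' (ball x r) > 0"
      using ex_ball_measure_pos[OF \<rho>'_in r(1)] .
    define \<pi> where "\<pi> = distr \<rho>' borel (\<lambda>y. y - x)"
    have "AE y in \<rho>'. y \<in> ball x D" using conc \<rho>' \<rho>'_le(2) x by blast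
    then have in_ball: "AE y in \<rho>'. y - x \<in> cball 0 (real N)"
      by eventually_elim (use N in \<open>simp add: dist_norm norm_minus_commute\<close>)
    have "(\<lambda>y. y - x) \<in> borel_measurable \<rho>'"
      by (simp add: measurable_cong_sets[OF borel_prob_onD(2)[OF \<rho>'_in] refl])
    then have "\<pi> \<in> borel_prob_on (cball 0 (real N))"
      unfolding \<pi>_def using borel_prob_onD(1)[OF \<rho>'_in] in_ball
      by (intro distr_borel_prob_on) simp_all
    then have "self_energy w \<rho> \<le> self_energy w \<pi>" using \<rho> by (simp add: minimizer_on_def)
    also have "\<dots> = self_energy w \<rho>'" unfolding \<pi>_def by (rule self_energy_translate[OF \<rho>'_in])
    also have "\<dots> \<le> self_energy w \<tau>'" by (rule \<rho>'_le)
    also have "\<dots> < self_energy w \<rho>" by (rule \<tau>')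
    finally show False by simp
  qed
  moreover have "\<rho> \<in> borel_prob" using \<rho> by (simp add: minimizer_on_def borel_prob_on_def)
  ultimately have "minimizer_on w UNIV \<rho>" by (simp add: minimizer_on_def borel_prob_on_UNIV)
  then show ?thesis by (rule that)
qed

text \<open>
  Every ball around a point of the support has positive mass, so the concentration radius applies
  with any point of the support as centre.
\<close>

theorem minimizer_support_bounded:
  assumes lim: "(w \<longlongrightarrow> L) at_infinity" and q: "q < L"
  shows "\<exists>D>0. \<forall>\<rho>. minimizer_on w UNIV \<rho> \<longrightarrow> self_energy w \<rho> \<le> q \<longrightarrow>
    (\<forall>x\<in>measure_supp \<rho>. \<forall>y\<in>measure_supp \<rho>. dist x y \<le> D)"
proof -
  obtain q' where q': "q = ennreal q'" "0 \<le> q'" using q by (cases q) auto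
  obtain r D where r: "r > 0" "D > 0" and conc:
    "\<And>K \<rho> x. minimizer_on w K \<rho> \<Longrightarrow> self_energy w \<rho> \<le> ennreal q' \<Longrightarrow> measure \<rho> (ball x r) > 0
       \<Longrightarrow> AE y in \<rho>. y \<in> ball x D"
    using ex_minimizer_radius[OF lim, of q'] q q' by blast
  have "dist x y \<le> D" if min: "minimizer_on w UNIV \<rho>" and le: "self_energy w \<rho> \<le> q"
    and xy: "x \<in> measure_supp \<rho>" "y \<in> measure_supp \<rho>" for \<rho> x y
  proof (rule ccontr)
    assume "\<not> dist x y \<le> D"
    have \<rho>: "\<rho> \<in> borel_prob_on UNIV" using min by (simp add: minimizer_on_def)
    interpret prob_space \<rho> using \<rho> by (rule borel_prob_onD)
    note sets = borel_prob_onD(2)[OF \<rho>] and space = borel_prob_onD(3)[OF \<rho>]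
    have "emeasure \<rho> (ball x r) > 0" using xy(1) r by (auto simp: measure_supp_def)
    then have "measure \<rho> (ball x r) > 0" by (simp add: emeasure_eq_measure)
    then have "AE z in \<rho>. z \<in> ball x D"
      using conc min le unfolding q'(1) by blast
    then have "AE z in \<rho>. z \<notin> - cball x D" by (auto elim!: AE_mp)
    then have "emeasure \<rho> (- cball x D) = 0"
      using sets space by (subst (asm) AE_iff_measurable[of "- cball x D"]) auto
    moreover have "emeasure \<rho> (- cball x D) > 0"
      using xy(2) \<open>\<not> dist x y \<le> D\<close> by (auto simp: measure_supp_def)
    ultimately show False by simp
  qed
  then show ?thesis using r by blast
qed

text \<open>
  The potential of the uniform distribution on a ball of volume \<open>v\<close> is at most \<open>l + C / v\<close> everywhere,
  where \<open>l\<close> bounds the kernel outside a fixed ball and \<open>C\<close> is its integral over that ball.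
\<close>

theorem ex_self_energy_less:
  assumes lim: "(w \<longlongrightarrow> L) at_infinity"
    and int: "\<And>K. compact K \<Longrightarrow> (\<integral>\<^sup>+ x. w x * indicator K x \<partial>lborel) < \<infinity>"
    and b: "L < b"
  obtains \<rho> where "\<rho> \<in> borel_prob" "self_energy w \<rho> < b"
proof -
  obtain l' where l': "L < l'" "l' < b" using dense[OF b] by blast
  then obtain l where l: "l' = ennreal l" "0 \<le> l" by (cases l') auto
  obtain r where r: "\<And>z. norm z \<ge> r \<Longrightarrow> w z < l'"
    using order_tendstoD(2)[OF lim l'(1)] by (auto simp: eventually_at_infinity)
  define C where "C = (\<integral>\<^sup>+ x. w x * indicator (cball 0 r) x \<partial>lborel)"
  obtain C' where C': "C = ennreal C'" "0 \<le> C'"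
    using int[of "cball 0 r"] by (cases C) (auto simp: C_def)
  define v where "v n = measure lborel (cball (0 :: real ^ 'd) (real n))" for n
  have v_eq: "emeasure lborel (cball (0 :: real ^ 'd) (real n)) = ennreal (v n)" for n
    unfolding v_def by (rule emeasure_eq_ennreal_measure) (use emeasure_lborel_cball_finite[of "0 :: real ^ 'd" "real n"] in auto)
  have inc: "incseq (\<lambda>n. cball (0 :: real ^ 'd) (real n))"
    by (intro incseq_SucI subset_cball) simp
  have "(\<Union>n. cball 0 (real n)) = (UNIV :: (real ^ 'd) set)"
    by (auto intro: real_arch_simple)
  then have "(\<lambda>n. ennreal (v n)) \<longlonglongrightarrow> \<top>"
    unfolding v_eq[symmetric] using Lim_emeasure_incseq[of "\<lambda>n. cball (0 :: real ^ 'd) (real n)" lborel] inc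
    by (simp add: image_subset_iff)
  then have v_lim: "filterlim v at_top sequentially"
    by (simp add: ennreal_tendsto_top_eq_at_top)
  have [measurable]: "cball (0 :: real ^ 'd) s \<in> sets borel" for s by simp
  have pot: "(\<integral>\<^sup>+ y. w (x - y) * indicator (cball 0 (real n)) y \<partial>lborel) \<le> ennreal (l * v n + C')" for x n
  proof -
    have "(\<integral>\<^sup>+ y. w (x - y) * indicator (cball 0 (real n)) y \<partial>lborel)
       \<le> (\<integral>\<^sup>+ y. l' * indicator (cball 0 (real n)) y + w (y - x) * indicator (cball 0 r) (y - x) \<partial>lborel)"
    proof (intro nn_integral_mono)
      fix y
      show "w (x - y) * indicator (cball 0 (real n)) y
         \<le> l' * indicator (cball 0 (real n)) y + w (y - x) * indicator (cball 0 r) (y - x)"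
      proof (cases "y - x \<in> cball 0 r")
        case True
        have "w (x - y) = w (y - x)" using even[of "y - x"] by simp
        with True show ?thesis by (simp add: indicator_def add_increasing)
      next
        case False
        then have "w (y - x) \<le> l'" using r[of "y - x"] by simp
        moreover have "w (x - y) = w (y - x)" using even[of "y - x"] by simp
        ultimately have "w (x - y) \<le> l'" by metis
        with False show ?thesis by (simp add: indicator_def)
      qed
    qed
    also have "\<dots> = l' * ennreal (v n) + (\<integral>\<^sup>+ y. w (y - x) * indicator (cball 0 r) (y - x) \<partial>lborel)"
    proof (subst nn_integral_add)
      have "(\<integral>\<^sup>+ y. l' * indicator (cball (0 :: real ^ 'd) (real n)) y \<partial>lborel) = l' * ennreal (v n)"
        unfolding v_eq[symmetric] by (rule nn_integral_cmult_indicator) simp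
      then show "(\<integral>\<^sup>+ y. l' * indicator (cball (0 :: real ^ 'd) (real n)) y \<partial>lborel)
          + (\<integral>\<^sup>+ y. w (y - x) * indicator (cball 0 r) (y - x) \<partial>lborel)
        = l' * ennreal (v n) + (\<integral>\<^sup>+ y. w (y - x) * indicator (cball 0 r) (y - x) \<partial>lborel)"
        by simp
    qed measurable
    also have "(\<integral>\<^sup>+ y. w (y - x) * indicator (cball 0 r) (y - x) \<partial>lborel)
        = (\<integral>\<^sup>+ y. w y * indicator (cball 0 r) y \<partial>distr lborel borel ((+) (- x)))"
      by (subst nn_integral_distr) auto
    also have "\<dots> = C" unfolding C_def by (simp add: lborel_distr_plus)
    finally show ?thesis using l C' by (simp add: v_def ennreal_mult ennreal_plus)
  qed
  have "(\<lambda>n. ennreal (l + C' / v n)) \<longlonglongrightarrow> ennreal (l + 0)"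
    by (intro tendsto_intros real_tendsto_divide_at_top[OF tendsto_const v_lim])
  then have "\<forall>\<^sub>F n in sequentially. ennreal (l + C' / v n) < b"
    using l l' by (intro order_tendstoD(2)) auto
  moreover have "\<forall>\<^sub>F n in sequentially. 0 < v n"
    using v_lim by (simp add: filterlim_at_top_dense)
  ultimately have "\<forall>\<^sub>F n in sequentially. ennreal (l + C' / v n) < b \<and> 0 < v n"
    by eventually_elim simp
  then obtain n where n: "ennreal (l + C' / v n) < b" "0 < v n"
    using eventually_happens'[OF sequentially_bot] by blast
  define B where "B = cball (0 :: real ^ 'd) (real n)"
  have B: "B \<in> sets borel" "emeasure lborel B = ennreal (v n)" by (auto simp: B_def v_eq)
  define \<rho> where "\<rho> = uniform_measure lborel B"
  have prob: "prob_space \<rho>"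
    unfolding \<rho>_def using B n by (intro prob_space_uniform_measure) auto
  have \<rho>: "\<rho> \<in> borel_prob" using prob by (simp add: borel_prob_def \<rho>_def)
  have "self_energy w \<rho> \<le> (\<integral>\<^sup>+ x. ennreal (l + C' / v n) \<partial>\<rho>)"
    unfolding self_energy_def
  proof (intro nn_integral_mono)
    fix x
    have "(\<integral>\<^sup>+ y. w (x - y) \<partial>\<rho>) = (\<integral>\<^sup>+ y. w (x - y) * indicator B y \<partial>lborel) / ennreal (v n)"
      unfolding \<rho>_def B(2)[symmetric] using B by (intro nn_integral_uniform_measure) auto
    also have "\<dots> \<le> ennreal (l * v n + C') / ennreal (v n)"
      unfolding B_def by (intro divide_right_mono_ennreal pot)
    also have "\<dots> = ennreal (l + C' / v n)"
      using n l C' by (subst divide_ennreal) (auto simp: field_simps)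
    finally show "(\<integral>\<^sup>+ y. w (x - y) \<partial>\<rho>) \<le> ennreal (l + C' / v n)" .
  qed
  also have "\<dots> = ennreal (l + C' / v n)"
    using prob_space.emeasure_space_1[OF prob] by simp
  finally show ?thesis using \<rho> n that by auto
qed
end

section \<open>Reduction of the extended-real energy to a nonnegative kernel\<close>

text \<open>
  The pointwise identity \<open>f\<^sup>+ + (- m) = (f - m) + f\<^sup>-\<close> has only nonnegative terms if \<open>m \<le> 0\<close>, so it can be
  integrated in \<open>[0, \<infinity>]\<close>; the integral of \<open>f\<^sup>-\<close> is at most \<open>- m\<close> and may be subtracted.
\<close>

lemma ereal_lint_shift:
  fixes f :: "'a \<Rightarrow> ereal"
  assumes M: "prob_space M" and f [measurable]: "f \<in> borel_measurable M"
    and m: "m \<le> 0" "\<And>x. ereal m \<le> f x"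
  shows "ereal_lint M f = enn2ereal (\<integral>\<^sup>+ x. e2ennreal (f x - ereal m) \<partial>M) + ereal m"
proof -
  interpret prob_space M by (rule M)
  have point: "e2ennreal (f x) + ennreal (- m) = e2ennreal (f x - ereal m) + e2ennreal (- f x)" for x
  proof (cases "f x")
    case (real t)
    then show ?thesis using m(1) m(2)[of x]
      by (cases "t \<ge> 0") (simp_all add: ennreal_def[symmetric] ennreal_plus[symmetric] ennreal_neg del: ennreal_plus)
  next
    case PInf
    then show ?thesis by (simp add: top_ennreal_def[symmetric])
  qed (use m(2)[of x] in simp)
  define P where "P = (\<integral>\<^sup>+ x. e2ennreal (f x) \<partial>M)"
  define N where "N = (\<integral>\<^sup>+ x. e2ennreal (- f x) \<partial>M)"
  define S where "S = (\<integral>\<^sup>+ x. e2ennreal (f x - ereal m) \<partial>M)"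
  have "P + ennreal (- m) = (\<integral>\<^sup>+ x. e2ennreal (f x) + ennreal (- m) \<partial>M)"
    unfolding P_def by (subst nn_integral_add) (simp_all add: emeasure_space_1)
  also have "\<dots> = S + N"
    unfolding point S_def N_def by (rule nn_integral_add) measurable
  finally have sum: "P + ennreal (- m) = S + N" .
  have "N \<le> (\<integral>\<^sup>+ x. ennreal (- m) \<partial>M)"
    unfolding N_def
  proof (intro nn_integral_mono)
    fix x
    have "- f x \<le> ereal (- m)" using m(2)[of x] ereal_minus_le_minus[of "f x" "ereal m"] by simp
    then have "e2ennreal (- f x) \<le> e2ennreal (ereal (- m))" by (rule e2ennreal_mono)
    then show "e2ennreal (- f x) \<le> ennreal (- m)" by simp
  qed
  also have "\<dots> = ennreal (- m)" by (simp add: emeasure_space_1)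
  finally have "N \<noteq> \<top>" by (auto simp: top_unique)
  then obtain n where n: "N = ennreal n" "0 \<le> n" by (cases N) auto
  have "enn2ereal P - enn2ereal N = enn2ereal S + ereal m"
  proof (cases P)
    case (real p)
    then have "S \<noteq> \<top>" using sum n m(1) by (auto simp flip: ennreal_plus)
    then obtain s where s: "S = ennreal s" "0 \<le> s" by (cases S) auto
    have "ennreal (p - m) = ennreal (s + n)"
      using sum real n s m(1) by (simp add: ennreal_plus[symmetric] del: ennreal_plus)
    then have "p - m = s + n" using real n s m(1) by (simp del: ennreal_plus)
    then show ?thesis using real n s by (simp add: enn2ereal_ennreal)
  next
    case top
    then have "S = \<top>" using sum n by (cases S) (auto simp flip: ennreal_plus)
    then show ?thesis using top n by (simp add: enn2ereal_ennreal)
  qed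
  then show ?thesis unfolding ereal_lint_def P_def N_def S_def .
qed

definition shifted_kernel :: "(real ^ 'd \<Rightarrow> ereal) \<Rightarrow> real \<Rightarrow> real ^ 'd \<Rightarrow> ennreal" where
  "shifted_kernel W m x = e2ennreal (W x - ereal m)"

lemma closed_measure_supp: "closed (measure_supp \<rho>)"
  unfolding closed_def
proof (subst open_subopen, safe)
  fix x assume "x \<notin> measure_supp \<rho>"
  then obtain U where "open U" "x \<in> U" "\<not> emeasure \<rho> U > 0"
    by (auto simp: measure_supp_def)
  then show "\<exists>T. open T \<and> x \<in> T \<and> T \<subseteq> - measure_supp \<rho>"
    by (intro exI[of _ U]) (auto simp: measure_supp_def)
qed

text \<open>
  The limit inferior is taken over punctured neighbourhoods; the centre satisfies the strict
  inequality by assumption.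
\<close>

lemma open_superlevel:
  assumes "lower_semicontinuous f"
  shows "open {x. a < f x}"
proof (subst open_subopen, safe)
  fix x assume a: "a < f x"
  then have "a < Liminf (at x) f"
    using assms by (auto simp: lower_semicontinuous_def intro: less_le_trans)
  then obtain S where "open S" "x \<in> S" "\<forall>y\<in>S. y \<noteq> x \<longrightarrow> a < f y"
    using less_LiminfD[of a "at x" f] by (auto simp: eventually_at_topological)
  then show "\<exists>T. open T \<and> x \<in> T \<and> T \<subseteq> {x. a < f x}"
    using a by (intro exI[of _ S]) auto
qed

lemma less_shifted_kernel_iff: "a < shifted_kernel W m x \<longleftrightarrow> enn2ereal a + ereal m < W x"
proof -
  have "a < shifted_kernel W m x \<longleftrightarrow> enn2ereal a < W x - ereal m"
  proof (cases "0 \<le> W x - ereal m")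
    case True
    then show ?thesis
      by (simp add: shifted_kernel_def less_ennreal.rep_eq enn2ereal_e2ennreal)
  next
    case False
    then have "\<not> enn2ereal a < W x - ereal m" "shifted_kernel W m x = 0"
      using le_less_trans[OF enn2ereal_nonneg, of a "W x - ereal m"]
      by (auto simp: shifted_kernel_def e2ennreal_neg not_le)
    then show ?thesis by simp
  qed
  also have "\<dots> \<longleftrightarrow> enn2ereal a + ereal m < W x"
    by (cases "W x"; cases a) (auto simp: enn2ereal_ennreal)
  finally show ?thesis .
qed

lemma lsc_kernel_shifted:
  assumes "lower_semicontinuous W" "\<And>x. W (- x) = W x"
  shows "lsc_kernel (shifted_kernel W m)"
proof
  show "open {x. a < shifted_kernel W m x}" for a
    unfolding less_shifted_kernel_iff using assms(1) by (rule open_superlevel)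
  show "shifted_kernel W m (- x) = shifted_kernel W m x" for x
    by (simp add: shifted_kernel_def assms(2))
qed

lemma energy_eq_self_energy:
  assumes W: "lower_semicontinuous W" "\<And>x. W (- x) = W x" and m: "m \<le> 0" "\<And>x. ereal m \<le> W x"
    and \<rho>: "\<rho> \<in> borel_prob"
  shows "energy W \<rho> = ereal (1/2) * (enn2ereal (self_energy (shifted_kernel W m) \<rho>) + ereal m)"
proof -
  interpret lsc_kernel "shifted_kernel W m" by (rule lsc_kernel_shifted[OF W])
  have \<rho>U: "\<rho> \<in> borel_prob_on UNIV" using \<rho> by (simp add: borel_prob_on_UNIV)
  note ps = borel_prob_onD(1)[OF \<rho>U]
  note [measurable_cong] = borel_prob_onD(2)[OF \<rho>U]
  have [measurable]: "W \<in> borel_measurable borel"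
    by (rule borel_measurableI_greater) (simp add: open_superlevel[OF W(1)])
  define V where "V x = (\<integral>\<^sup>+ y. shifted_kernel W m (x - y) \<partial>\<rho>)" for x
  have V [measurable]: "V \<in> borel_measurable borel"
    using measurable_potential[OF \<rho>U, of UNIV] by (simp add: V_def[abs_def])
  have inner: "ereal_lint \<rho> (\<lambda>y. W (x - y)) = enn2ereal (V x) + ereal m" for x
  proof -
    have "(\<lambda>y. W (x - y)) \<in> borel_measurable \<rho>" by measurable
    from ereal_lint_shift[OF ps this m(1) m(2)] show ?thesis
      by (simp add: V_def shifted_kernel_def)
  qed
  have V_ge: "ereal m \<le> enn2ereal (V x) + ereal m" for x
    using add_right_mono[OF enn2ereal_nonneg, of "ereal m" "V x"] by simp
  have "(\<lambda>x. enn2ereal (V x) + ereal m) \<in> borel_measurable \<rho>" by measurable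
  from ereal_lint_shift[OF ps this m(1) V_ge]
  have "ereal_lint \<rho> (\<lambda>x. enn2ereal (V x) + ereal m)
      = enn2ereal (\<integral>\<^sup>+ x. e2ennreal (enn2ereal (V x) + ereal m - ereal m) \<partial>\<rho>) + ereal m" .
  moreover have "e2ennreal (enn2ereal (V x) + ereal m - ereal m) = V x" for x
    by (cases "V x") (auto simp: enn2ereal_ennreal)
  ultimately show ?thesis
    by (simp add: energy_def inner self_energy_def V_def)
qed

text \<open>
  The affine map from \<open>Q\<close> to the energy is strictly increasing on all of \<open>[0, \<infinity>]\<close>. Applied to \<open>L\<close>, it
  gives half the limit of the original kernel.
\<close>

lemma half_shift_le_iff:
  "ereal (1/2) * (enn2ereal a + ereal m) \<le> ereal (1/2) * (enn2ereal b + ereal m) \<longleftrightarrow> a \<le> b"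
  by (cases a; cases b) (auto simp: enn2ereal_ennreal top_unique)

lemma tendsto_shifted_kernel:
  assumes W: "(W \<longlongrightarrow> Winf) at_infinity"
  shows "(shifted_kernel W m \<longlongrightarrow> e2ennreal (Winf - ereal m)) at_infinity"
  unfolding shifted_kernel_def minus_ereal_def
  by (intro tendsto_e2ennrealI tendsto_add_ereal_general W tendsto_const) auto

lemma shifted_kernel_integral_finite:
  assumes W: "locally_integrable W" and lsc: "lower_semicontinuous W"
    and m: "m \<le> 0" "\<And>x. ereal m \<le> W x" and K: "compact K"
  shows "(\<integral>\<^sup>+ x. shifted_kernel W m x * indicator K x \<partial>lborel) < \<infinity>"
proof -
  have [measurable]: "W \<in> borel_measurable borel"
    by (rule borel_measurableI_greater) (simp add: open_superlevel[OF lsc])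
  have [measurable]: "K \<in> sets borel" using K by (simp add: borel_compact)
  have le: "shifted_kernel W m x \<le> e2ennreal \<bar>W x\<bar> + ennreal (- m)" for x
    unfolding shifted_kernel_def using m(1) m(2)[of x]
    by (cases "W x") (auto simp: ennreal_def[symmetric] ennreal_plus[symmetric] top_ennreal_def[symmetric]
         simp del: ennreal_plus intro!: ennreal_leI)
  have "(\<integral>\<^sup>+ x. shifted_kernel W m x * indicator K x \<partial>lborel)
      \<le> (\<integral>\<^sup>+ x. e2ennreal \<bar>W x\<bar> * indicator K x + ennreal (- m) * indicator K x \<partial>lborel)"
    by (intro nn_integral_mono) (use le in \<open>auto simp: indicator_def\<close>)
  also have "\<dots> = (\<integral>\<^sup>+ x. e2ennreal \<bar>W x\<bar> * indicator K x \<partial>lborel) + ennreal (- m) * emeasure lborel K"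
    by (subst nn_integral_add) (simp_all add: nn_integral_cmult)
  also have "(\<integral>\<^sup>+ x. e2ennreal \<bar>W x\<bar> * indicator K x \<partial>lborel)
      = (\<integral>\<^sup>+ x. e2ennreal \<bar>W x\<bar> * indicator K x \<partial>lebesgue)"
    by (rule nn_integral_completion[symmetric])
  also have "\<dots> + ennreal (- m) * emeasure lborel K < \<infinity>"
    using W K emeasure_compact_finite[OF K]
    by (auto simp: locally_integrable_def ennreal_mult_less_top)
  finally show ?thesis .
qed

section \<open>Existence and support of minimizers for the original kernel\<close>

theorem theorem1p1:
  fixes W :: "real ^ 'd \<Rightarrow> ereal" and Winf :: ereal
  assumes "\<forall>x. W x \<noteq> -\<infinity>"
    and "locally_integrable W"
    and "\<exists>m::real. \<forall>x. ereal m \<le> W x"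
    and "lower_semicontinuous W"
    and "\<forall>x. W x = W (- x)"
    and "Winf \<noteq> -\<infinity>"
    and "(W \<longlongrightarrow> Winf) at_infinity"
  shows "((\<exists>\<rho>. energy_minimizer W \<rho>) \<longleftrightarrow>
           (\<exists>\<rho>\<in>borel_prob. energy W \<rho> \<le> ereal (1/2) * Winf)) \<and>
         ((\<exists>\<rho>\<in>borel_prob. energy W \<rho> < ereal (1/2) * Winf) \<longleftrightarrow>
           (INF \<rho>\<in>borel_prob. energy W \<rho>) < ereal (1/2) * Winf) \<and>
         ((\<exists>\<rho>\<in>borel_prob. energy W \<rho> < ereal (1/2) * Winf) \<longrightarrow>
           (\<forall>\<rho>. energy_minimizer W \<rho> \<longrightarrow> compact (measure_supp \<rho>)) \<and>
           (\<exists>R::real. R > 0 \<and>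
             (\<forall>\<rho>. energy_minimizer W \<rho> \<longrightarrow> diameter (measure_supp \<rho>) \<le> R)))"
proof -
  obtain m0 where m0: "\<And>x. ereal m0 \<le> W x" using assms(3) by blast
  \<comment> \<open>The shift of integrals needs a lower bound that is not positive.\<close>
  define m where "m = min m0 0"
  have m: "m \<le> 0" "\<And>x. ereal m \<le> W x"
    using m0 order_trans[of "ereal m" "ereal m0"] by (auto simp: m_def)
  have W_even: "W (- x) = W x" for x using assms(5) by metis
  define w where "w = shifted_kernel W m"
  interpret lsc_kernel w unfolding w_def by (rule lsc_kernel_shifted[OF assms(4) W_even])
  define L where "L = e2ennreal (Winf - ereal m)"
  have "ereal m \<le> Winf"
    by (rule tendsto_lowerbound[OF assms(7)]) (use m(2) trivial_limit_at_infinity in auto)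
  then have Winf: "Winf = enn2ereal L + ereal m"
    unfolding L_def by (cases Winf) (auto simp: enn2ereal_e2ennreal)
  have lim: "(w \<longlongrightarrow> L) at_infinity"
    unfolding w_def L_def by (rule tendsto_shifted_kernel[OF assms(7)])
  have energy: "energy W \<rho> = ereal (1/2) * (enn2ereal (self_energy w \<rho>) + ereal m)"
    if "\<rho> \<in> borel_prob" for \<rho>
    unfolding w_def by (rule energy_eq_self_energy[OF assms(4) W_even m that])
  have le_iff: "energy W \<rho> \<le> ereal (1/2) * Winf \<longleftrightarrow> self_energy w \<rho> \<le> L" if "\<rho> \<in> borel_prob" for \<rho>
    unfolding energy[OF that] Winf by (rule half_shift_le_iff)
  have less_iff: "energy W \<rho> < ereal (1/2) * Winf \<longleftrightarrow> self_energy w \<rho> < L" if "\<rho> \<in> borel_prob" for \<rho>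
    unfolding energy[OF that] Winf by (simp only: half_shift_le_iff not_le[symmetric])
  have min_iff: "energy_minimizer W \<rho> \<longleftrightarrow> minimizer_on w UNIV \<rho>" for \<rho>
    unfolding energy_minimizer_def minimizer_on_def borel_prob_on_UNIV
    by (auto simp: energy half_shift_le_iff)
  have "(\<exists>\<rho>. minimizer_on w UNIV \<rho>) \<longleftrightarrow> (\<exists>\<rho>\<in>borel_prob. self_energy w \<rho> \<le> L)"
  proof
    assume "\<exists>\<rho>. minimizer_on w UNIV \<rho>"
    then obtain \<rho> where \<rho>: "\<rho> \<in> borel_prob" "\<And>\<sigma>. \<sigma> \<in> borel_prob \<Longrightarrow> self_energy w \<rho> \<le> self_energy w \<sigma>"
      by (auto simp: minimizer_on_def borel_prob_on_UNIV)
    have "self_energy w \<rho> \<le> L"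
    proof (rule ccontr)
      assume "\<not> self_energy w \<rho> \<le> L"
      then have "L < self_energy w \<rho>" by simp
      moreover have "(\<integral>\<^sup>+ x. w x * indicator K x \<partial>lborel) < \<infinity>" if "compact K" for K
        unfolding w_def by (rule shifted_kernel_integral_finite[OF assms(2,4) m that])
      ultimately obtain \<sigma> where "\<sigma> \<in> borel_prob" "self_energy w \<sigma> < self_energy w \<rho>"
        using ex_self_energy_less[OF lim] by metis
      with \<rho>(2)[of \<sigma>] show False by simp
    qed
    with \<rho>(1) show "\<exists>\<rho>\<in>borel_prob. self_energy w \<rho> \<le> L" by blast
  next
    assume "\<exists>\<rho>\<in>borel_prob. self_energy w \<rho> \<le> L"
    then obtain \<rho> where \<rho>: "\<rho> \<in> borel_prob" "self_energy w \<rho> \<le> L" by blast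
    show "\<exists>\<rho>. minimizer_on w UNIV \<rho>"
    proof (cases "minimizer_on w UNIV \<rho>")
      case False
      then obtain \<sigma> where "\<sigma> \<in> borel_prob" "self_energy w \<sigma> < self_energy w \<rho>"
        using \<rho>(1) by (auto simp: minimizer_on_def borel_prob_on_UNIV not_le)
      with \<rho>(2) show ?thesis using ex_minimizer[OF lim, of \<sigma>] by (metis less_le_trans)
    qed blast
  qed
  then have existence: "(\<exists>\<rho>. energy_minimizer W \<rho>) \<longleftrightarrow>
      (\<exists>\<rho>\<in>borel_prob. energy W \<rho> \<le> ereal (1/2) * Winf)"
    unfolding min_iff using le_iff by auto
  have support: "(\<forall>\<rho>. energy_minimizer W \<rho> \<longrightarrow> compact (measure_supp \<rho>)) \<and>
      (\<exists>R::real. R > 0 \<and> (\<forall>\<rho>. energy_minimizer W \<rho> \<longrightarrow> diameter (measure_supp \<rho>) \<le> R))"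
    if below: "\<exists>\<rho>\<in>borel_prob. energy W \<rho> < ereal (1/2) * Winf"
  proof -
    obtain \<sigma> where \<sigma>: "\<sigma> \<in> borel_prob" "self_energy w \<sigma> < L"
      using below less_iff by blast
    have le: "self_energy w \<rho> \<le> self_energy w \<sigma>" if "minimizer_on w UNIV \<rho>" for \<rho>
      using that \<sigma>(1) by (auto simp: minimizer_on_def borel_prob_on_UNIV)
    \<comment> \<open>All minimizers have at most the energy of the same \<open>\<sigma>\<close>, so one radius serves them all.\<close>
    obtain D where D: "D > 0"
      "\<And>\<rho> x y. minimizer_on w UNIV \<rho> \<Longrightarrow> x \<in> measure_supp \<rho> \<Longrightarrow> y \<in> measure_supp \<rho> \<Longrightarrow> dist x y \<le> D"
      using minimizer_support_bounded[OF lim \<sigma>(2)] le by blast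
    have "compact (measure_supp \<rho>)" "diameter (measure_supp \<rho>) \<le> D" if "minimizer_on w UNIV \<rho>" for \<rho>
    proof -
      have "closed (measure_supp \<rho>)"
        by (rule closed_measure_supp)
      moreover have "bounded (measure_supp \<rho>)"
        unfolding bounded_def using D(2)[OF that] by (cases "measure_supp \<rho> = {}") blast+
      ultimately show "compact (measure_supp \<rho>)" by (simp add: compact_eq_bounded_closed)
      show "diameter (measure_supp \<rho>) \<le> D"
        using D(1) D(2)[OF that] by (intro diameter_le) (auto simp: dist_norm)
    qed
    with D(1) show ?thesis unfolding min_iff by blast
  qed
  show ?thesis
    using existence support by (simp add: INF_less_iff)
qed

end
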